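(* Let $\mathcal{B}$ be a topos. The arrow category $\mathsf{Adj}(\mathcal{B})_{=}^{\mathsf 2}$ of the category $\mathsf{Adj}(\mathcal{B})_{=}$ of internal partial orders and order adjunctions is equivalent to the factorization category $\mathsf{Ref}(\mathcal{B})\odot\mathsf{Ref}(\mathcal{B})^{\propto}$ of reflection–coreflection factorizations: \[\mathsf{Adj}(\mathcal{B})_{=}^{\mathsf 2}\equiv\mathsf{Ref}(\mathcal{B})\odot\mathsf{Ref}(\mathcal{B})^{\propto},\] the equivalence being mediated by polar factorization and composition of adjunctions.
   Context: Internal preorders/partial orders in a topos $\mathcal B$ are objects with a reflexive transitive (resp. also antisymmetric) internal relation; monotonic morphisms preserve order and are ordered pointwise internally. An order adjunction $\mathbf g=\langle\check{\mathbf g},\hat{\mathbf g}\rangle:\mathbf A_0\rightleftharpoons\mathbf A_1$ consists of monotonic $\check{\mathbf g}:\mathbf A_0\to\mathbf A_1$, $\hat{\mathbf g}:\mathbf A_1\to\mathbf A_0$ with $1\le\hat{\mathbf g}\circ\check{\mathbf g}$ and $\check{\mathbf g}\circ\hat{\mathbf g}\le1$; composition ($\mathbf g$ followed by $\mathbf h$) is $\langle\check{\mathbf h}\circ\check{\mathbf g},\hat{\mathbf g}\circ\hat{\mathbf h}\rangle$. $\mathsf{Ref}(\mathcal B)$ is the class of reflections ($\check{\mathbf g}\circ\hat{\mathbf g}=1_{A_1}$) and $\mathsf{Ref}(\mathcal B)^{\propto}$ the class of coreflections ($\hat{\mathbf g}\circ\check{\mathbf g}=1_{A_0}$). The arrow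 category $\mathsf{Adj}(\mathcal B)_{=}^{\mathsf 2}$ has objects adjunctions $(\mathbf A,\mathbf g,\mathbf B)$ and morphisms $(\mathbf a,\mathbf b):(\mathbf A_1,\mathbf g_1,\mathbf B_1)\to(\mathbf A_2,\mathbf g_2,\mathbf B_2)$ pairs of adjunctions with ($\mathbf a$ followed by $\mathbf g_2$) $=$ ($\mathbf g_1$ followed by $\mathbf b$). The category $\mathsf{Ref}(\mathcal B)\odot\mathsf{Ref}(\mathcal B)^{\propto}$ has objects quintuples $(\mathbf A,\mathbf e,\mathbf C,\mathbf m,\mathbf B)$ with $\mathbf e:\mathbf A\rightleftharpoons\mathbf C$ a reflection and $\mathbf m:\mathbf C\rightleftharpoons\mathbf B$ a coreflection between internal partial orders, and morphisms triples of adjunctions $(\mathbf a,\mathbf c,\mathbf b)$ with ($\mathbf a$ then $\mathbf e_2$) $=$ ($\mathbf e_1$ then $\mathbf c$) and ($\mathbf c$ then $\mathbf m_2$) $=$ ($\mathbf m_1$ then $\mathbf b$). Polar factorization sends an adjunction $\mathbf g$ to its factorization through its axis $\diamondsuit(\mathbf g)$ (the internal poset of pairs $(a,b)$ with $a$ closed, $b$ open, $a=\hat{\mathbf g}(b)$, $b=\check{\mathbf g}(a)$) as an extent reflection $\mathbf A_0\rightleftharpoons\diamondsuit(\mathbf g)$ followed by an intent coreflection $\diamondsuit(\mathbf g)\rightleftharpoons\mathbf A_1$; composition sends $(\mathbf A,\mathbf e,\mathbf C,\mathbf m,\mathbf B)$ to $\mathbf e$ followed by $\mathbf m$. *)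

theory Defs
  imports Main
begin

section \<open>Categories, functors, equivalences\<close>

record ('o, 'm) cat =
  Obj :: "'o set"
  Arr :: "'m set"
  Dom :: "'m \<Rightarrow> 'o"
  Cod :: "'m \<Rightarrow> 'o"
  Id :: "'o \<Rightarrow> 'm"
  Comp :: "'m \<Rightarrow> 'm \<Rightarrow> 'm" (infixr "\<cdot>\<index>" 70)

text \<open>Composition is in applicative order: \<open>g \<cdot> f\<close> is \<open>f\<close> followed by \<open>g\<close>.\<close>

definition Hom :: "('o, 'm) cat \<Rightarrow> 'o \<Rightarrow> 'o \<Rightarrow> 'm set" where
  "Hom C X Y = {f \<in> Arr C. Dom C f = X \<and> Cod C f = Y}"

locale category =
  fixes C :: "('o, 'm) cat" (structure)
  assumes dom_obj: "f \<in> Arr C \<Longrightarrow> Dom C f \<in> Obj C"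
    and cod_obj: "f \<in> Arr C \<Longrightarrow> Cod C f \<in> Obj C"
    and id_hom: "X \<in> Obj C \<Longrightarrow> Id C X \<in> Hom C X X"
    and comp_hom: "\<lbrakk>f \<in> Hom C X Y; g \<in> Hom C Y Z\<rbrakk> \<Longrightarrow> g \<cdot> f \<in> Hom C X Z"
    and comp_id: "f \<in> Hom C X Y \<Longrightarrow> f \<cdot> Id C X = f"
    and id_comp: "f \<in> Hom C X Y \<Longrightarrow> Id C Y \<cdot> f = f"
    and comp_assoc: "\<lbrakk>f \<in> Hom C W X; g \<in> Hom C X Y; h \<in> Hom C Y Z\<rbrakk>
                      \<Longrightarrow> (h \<cdot> g) \<cdot> f = h \<cdot> (g \<cdot> f)"

definition is_iso :: "('o, 'm) cat \<Rightarrow> 'm \<Rightarrow> bool" where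
  "is_iso C f \<longleftrightarrow> f \<in> Arr C \<and>
     (\<exists>g \<in> Hom C (Cod C f) (Dom C f).
        g \<cdot>\<^bsub>C\<^esub> f = Id C (Dom C f) \<and> f \<cdot>\<^bsub>C\<^esub> g = Id C (Cod C f))"

record ('o, 'm, 'p, 'n) fctr =
  FObj :: "'o \<Rightarrow> 'p"
  FArr :: "'m \<Rightarrow> 'n"

definition is_functor :: "('o, 'm) cat \<Rightarrow> ('p, 'n) cat \<Rightarrow> ('o, 'm, 'p, 'n) fctr \<Rightarrow> bool" where
  "is_functor C D F \<longleftrightarrow> category C \<and> category D \<and>
     (\<forall>X \<in> Obj C. FObj F X \<in> Obj D) \<and>
     (\<forall>X Y. \<forall>f \<in> Hom C X Y. FArr F f \<in> Hom D (FObj F X) (FObj F Y)) \<and>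
     (\<forall>X \<in> Obj C. FArr F (Id C X) = Id D (FObj F X)) \<and>
     (\<forall>X Y Z. \<forall>f \<in> Hom C X Y. \<forall>g \<in> Hom C Y Z.
        FArr F (g \<cdot>\<^bsub>C\<^esub> f) = FArr F g \<cdot>\<^bsub>D\<^esub> FArr F f)"

definition fctr_id :: "('o, 'm, 'o, 'm) fctr" where
  "fctr_id = \<lparr>FObj = (\<lambda>X. X), FArr = (\<lambda>f. f)\<rparr>"

definition fctr_comp ::
  "('p, 'n, 'q, 'k) fctr \<Rightarrow> ('o, 'm, 'p, 'n) fctr \<Rightarrow> ('o, 'm, 'q, 'k) fctr" where
  "fctr_comp G F = \<lparr>FObj = FObj G \<circ> FObj F, FArr = FArr G \<circ> FArr F\<rparr>"

definition naturally_isomorphic ::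
  "('o, 'm) cat \<Rightarrow> ('p, 'n) cat \<Rightarrow> ('o, 'm, 'p, 'n) fctr \<Rightarrow> ('o, 'm, 'p, 'n) fctr \<Rightarrow> bool" where
  "naturally_isomorphic C D F G \<longleftrightarrow> is_functor C D F \<and> is_functor C D G \<and>
     (\<exists>\<eta>. (\<forall>X \<in> Obj C. \<eta> X \<in> Hom D (FObj F X) (FObj G X) \<and> is_iso D (\<eta> X)) \<and>
          (\<forall>X Y. \<forall>f \<in> Hom C X Y. FArr G f \<cdot>\<^bsub>D\<^esub> \<eta> X = \<eta> Y \<cdot>\<^bsub>D\<^esub> FArr F f))"

definition equivalence_of_categories ::
  "('o, 'm) cat \<Rightarrow> ('p, 'n) cat \<Rightarrow> ('o, 'm, 'p, 'n) fctr \<Rightarrow> ('p, 'n, 'o, 'm) fctr \<Rightarrow> bool" where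
  "equivalence_of_categories C D F G \<longleftrightarrow>
     is_functor C D F \<and> is_functor D C G \<and>
     naturally_isomorphic C C fctr_id (fctr_comp G F) \<and>
     naturally_isomorphic D D (fctr_comp F G) fctr_id"


section \<open>Elementary toposes\<close>

definition is_terminal :: "('o, 'm) cat \<Rightarrow> 'o \<Rightarrow> bool" where
  "is_terminal C T \<longleftrightarrow> T \<in> Obj C \<and> (\<forall>X \<in> Obj C. \<exists>!f. f \<in> Hom C X T)"

definition is_mono :: "('o, 'm) cat \<Rightarrow> 'm \<Rightarrow> bool" where
  "is_mono C m \<longleftrightarrow> m \<in> Arr C \<and>
     (\<forall>X. \<forall>h \<in> Hom C X (Dom C m). \<forall>k \<in> Hom C X (Dom C m).
        m \<cdot>\<^bsub>C\<^esub> h = m \<cdot>\<^bsub>C\<^esub> k \<longrightarrow> h = k)"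

definition is_product :: "('o, 'm) cat \<Rightarrow> 'o \<Rightarrow> 'o \<Rightarrow> 'o \<Rightarrow> 'm \<Rightarrow> 'm \<Rightarrow> bool" where
  "is_product C X Y P p q \<longleftrightarrow> p \<in> Hom C P X \<and> q \<in> Hom C P Y \<and>
     (\<forall>Z. \<forall>f \<in> Hom C Z X. \<forall>g \<in> Hom C Z Y.
        \<exists>!h. h \<in> Hom C Z P \<and> p \<cdot>\<^bsub>C\<^esub> h = f \<and> q \<cdot>\<^bsub>C\<^esub> h = g)"

definition is_pullback :: "('o, 'm) cat \<Rightarrow> 'm \<Rightarrow> 'm \<Rightarrow> 'o \<Rightarrow> 'm \<Rightarrow> 'm \<Rightarrow> bool" where
  "is_pullback C f g P p q \<longleftrightarrow>
     f \<in> Arr C \<and> g \<in> Arr C \<and> Cod C f = Cod C g \<and>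
     p \<in> Hom C P (Dom C f) \<and> q \<in> Hom C P (Dom C g) \<and> f \<cdot>\<^bsub>C\<^esub> p = g \<cdot>\<^bsub>C\<^esub> q \<and>
     (\<forall>Z. \<forall>u \<in> Hom C Z (Dom C f). \<forall>v \<in> Hom C Z (Dom C g). f \<cdot>\<^bsub>C\<^esub> u = g \<cdot>\<^bsub>C\<^esub> v \<longrightarrow>
        (\<exists>!h. h \<in> Hom C Z P \<and> p \<cdot>\<^bsub>C\<^esub> h = u \<and> q \<cdot>\<^bsub>C\<^esub> h = v))"

text \<open>\<open>E\<close> is \<open>Y\<^sup>X\<close>, with evaluation \<open>ev\<close> defined on a product \<open>P\<close> of \<open>E\<close> and \<open>X\<close>;
  the arrow \<open>k\<close> below is \<open>h \<times> 1\<close>.\<close>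

definition is_exponential ::
  "('o, 'm) cat \<Rightarrow> 'o \<Rightarrow> 'o \<Rightarrow> 'o \<Rightarrow> 'o \<Rightarrow> 'm \<Rightarrow> 'm \<Rightarrow> 'm \<Rightarrow> bool" where
  "is_exponential C X Y E P p q ev \<longleftrightarrow> is_product C E X P p q \<and> ev \<in> Hom C P Y \<and>
     (\<forall>Z Q r s. \<forall>f \<in> Hom C Q Y. is_product C Z X Q r s \<longrightarrow>
        (\<exists>!h. h \<in> Hom C Z E \<and>
           (\<exists>k \<in> Hom C Q P. p \<cdot>\<^bsub>C\<^esub> k = h \<cdot>\<^bsub>C\<^esub> r \<and> q \<cdot>\<^bsub>C\<^esub> k = s \<and> ev \<cdot>\<^bsub>C\<^esub> k = f)))"

definition is_subobject_classifier :: "('o, 'm) cat \<Rightarrow> 'm \<Rightarrow> bool" where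
  "is_subobject_classifier C tr \<longleftrightarrow> tr \<in> Arr C \<and> is_terminal C (Dom C tr) \<and>
     (\<forall>m. is_mono C m \<longrightarrow>
        (\<exists>!\<chi>. \<chi> \<in> Hom C (Cod C m) (Cod C tr) \<and>
           (\<exists>t. is_pullback C \<chi> tr (Dom C m) m t)))"

locale topos = category B for B :: "('o, 'm) cat" (structure) +
  assumes has_terminal: "\<exists>T. is_terminal B T"
    and has_pullbacks: "\<lbrakk>f \<in> Hom B X Z; g \<in> Hom B Y Z\<rbrakk> \<Longrightarrow> \<exists>P p q. is_pullback B f g P p q"
    and has_exponentials:
      "\<lbrakk>X \<in> Obj B; Y \<in> Obj B\<rbrakk> \<Longrightarrow> \<exists>E P p q ev. is_exponential B X Y E P p q ev"
    and has_subobject_classifier: "\<exists>tr. is_subobject_classifier B tr"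


section \<open>Internal orders\<close>

text \<open>An internal relation on \<open>carr\<close> is a subobject of \<open>carr \<times> carr\<close>, presented as a
  jointly monic span \<open>fstp, sndp : rel \<rightarrow> carr\<close>.\<close>

record ('o, 'm) iord =
  carr :: 'o
  rel :: 'o
  fstp :: 'm
  sndp :: 'm

definition internal_relation :: "('o, 'm) cat \<Rightarrow> ('o, 'm) iord \<Rightarrow> bool" where
  "internal_relation B A \<longleftrightarrow>
     fstp A \<in> Hom B (rel A) (carr A) \<and> sndp A \<in> Hom B (rel A) (carr A) \<and>
     (\<forall>X. \<forall>h \<in> Hom B X (rel A). \<forall>k \<in> Hom B X (rel A).
        fstp A \<cdot>\<^bsub>B\<^esub> h = fstp A \<cdot>\<^bsub>B\<^esub> k \<and> sndp A \<cdot>\<^bsub>B\<^esub> h = sndp A \<cdot>\<^bsub>B\<^esub> k \<longrightarrow> h = k)"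

text \<open>For parallel arrows \<open>u, v : X \<rightarrow> carr A\<close> (generalized elements at stage \<open>X\<close>),
  \<open>ile B A u v\<close> says that \<open>\<langle>u, v\<rangle>\<close> factors through the relation. For arrows between
  orders this is the internal pointwise order. The order properties are the usual internal
  ones, expressed with generalized elements.\<close>

definition ile :: "('o, 'm) cat \<Rightarrow> ('o, 'm) iord \<Rightarrow> 'm \<Rightarrow> 'm \<Rightarrow> bool" where
  "ile B A u v \<longleftrightarrow>
     (\<exists>h \<in> Hom B (Dom B u) (rel A). fstp A \<cdot>\<^bsub>B\<^esub> h = u \<and> sndp A \<cdot>\<^bsub>B\<^esub> h = v)"

definition internal_preorder :: "('o, 'm) cat \<Rightarrow> ('o, 'm) iord \<Rightarrow> bool" where
  "internal_preorder B A \<longleftrightarrow> internal_relation B A \<and>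
     (\<forall>X. \<forall>u \<in> Hom B X (carr A). ile B A u u) \<and>
     (\<forall>X. \<forall>u \<in> Hom B X (carr A). \<forall>v \<in> Hom B X (carr A). \<forall>w \<in> Hom B X (carr A).
        ile B A u v \<and> ile B A v w \<longrightarrow> ile B A u w)"

definition internal_partial_order :: "('o, 'm) cat \<Rightarrow> ('o, 'm) iord \<Rightarrow> bool" where
  "internal_partial_order B A \<longleftrightarrow> internal_preorder B A \<and>
     (\<forall>X. \<forall>u \<in> Hom B X (carr A). \<forall>v \<in> Hom B X (carr A).
        ile B A u v \<and> ile B A v u \<longrightarrow> u = v)"

definition monotonic ::
  "('o, 'm) cat \<Rightarrow> ('o, 'm) iord \<Rightarrow> ('o, 'm) iord \<Rightarrow> 'm \<Rightarrow> bool" where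
  "monotonic B A0 A1 f \<longleftrightarrow> f \<in> Hom B (carr A0) (carr A1) \<and>
     (\<forall>X. \<forall>u \<in> Hom B X (carr A0). \<forall>v \<in> Hom B X (carr A0).
        ile B A0 u v \<longrightarrow> ile B A1 (f \<cdot>\<^bsub>B\<^esub> u) (f \<cdot>\<^bsub>B\<^esub> v))"


section \<open>Order adjunctions\<close>

record ('o, 'm) adj =
  asrc :: "('o, 'm) iord"
  atgt :: "('o, 'm) iord"
  ladj :: 'm
  radj :: 'm

definition order_adjunction :: "('o, 'm) cat \<Rightarrow> ('o, 'm) adj \<Rightarrow> bool" where
  "order_adjunction B g \<longleftrightarrow>
     monotonic B (asrc g) (atgt g) (ladj g) \<and> monotonic B (atgt g) (asrc g) (radj g) \<and>
     ile B (asrc g) (Id B (carr (asrc g))) (radj g \<cdot>\<^bsub>B\<^esub> ladj g) \<and>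
     ile B (atgt g) (ladj g \<cdot>\<^bsub>B\<^esub> radj g) (Id B (carr (atgt g)))"

definition Adj :: "('o, 'm) cat \<Rightarrow> (('o, 'm) iord, ('o, 'm) adj) cat" where
  "Adj B =
     \<lparr>Obj = {A. internal_partial_order B A},
      Arr = {g. internal_partial_order B (asrc g) \<and> internal_partial_order B (atgt g) \<and>
                order_adjunction B g},
      Dom = asrc,
      Cod = atgt,
      Id = (\<lambda>A. \<lparr>asrc = A, atgt = A, ladj = Id B (carr A), radj = Id B (carr A)\<rparr>),
      Comp = (\<lambda>h g. \<lparr>asrc = asrc g, atgt = atgt h,
                      ladj = ladj h \<cdot>\<^bsub>B\<^esub> ladj g, radj = radj g \<cdot>\<^bsub>B\<^esub> radj h\<rparr>)\<rparr>"

definition Ref :: "('o, 'm) cat \<Rightarrow> ('o, 'm) adj set" where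
  "Ref B = {g \<in> Arr (Adj B). ladj g \<cdot>\<^bsub>B\<^esub> radj g = Id B (carr (atgt g))}"

definition Coref :: "('o, 'm) cat \<Rightarrow> ('o, 'm) adj set" where
  "Coref B = {g \<in> Arr (Adj B). radj g \<cdot>\<^bsub>B\<^esub> ladj g = Id B (carr (asrc g))}"


section \<open>Arrow categories and factorization categories\<close>

text \<open>\<open>(f, a, b, g)\<close> is the morphism \<open>(a, b) : f \<rightarrow> g\<close>.\<close>

definition arrow_category :: "('o, 'm) cat \<Rightarrow> ('m, 'm \<times> 'm \<times> 'm \<times> 'm) cat" where
  "arrow_category C =
     \<lparr>Obj = Arr C,
      Arr = {(f, a, b, g). f \<in> Arr C \<and> g \<in> Arr C \<and>
               a \<in> Hom C (Dom C f) (Dom C g) \<and> b \<in> Hom C (Cod C f) (Cod C g) \<and>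
               g \<cdot>\<^bsub>C\<^esub> a = b \<cdot>\<^bsub>C\<^esub> f},
      Dom = (\<lambda>(f, a, b, g). f),
      Cod = (\<lambda>(f, a, b, g). g),
      Id = (\<lambda>f. (f, Id C (Dom C f), Id C (Cod C f), f)),
      Comp = (\<lambda>(f', a', b', g') (f, a, b, g). (f, a' \<cdot>\<^bsub>C\<^esub> a, b' \<cdot>\<^bsub>C\<^esub> b, g'))\<rparr>"

type_synonym ('o, 'm) quintuple = "'o \<times> 'm \<times> 'o \<times> 'm \<times> 'o"

text \<open>\<open>(F, a, c, b, F')\<close> is the morphism \<open>(a, c, b) : F \<rightarrow> F'\<close>.\<close>

definition factorization_category ::
  "('o, 'm) cat \<Rightarrow> 'm set \<Rightarrow> 'm set \<Rightarrow>
   (('o, 'm) quintuple, ('o, 'm) quintuple \<times> 'm \<times> 'm \<times> 'm \<times> ('o, 'm) quintuple) cat" where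
  "factorization_category C E M =
     (let Q = {(X, e, Z, m, Y). e \<in> E \<and> e \<in> Hom C X Z \<and> m \<in> M \<and> m \<in> Hom C Z Y} in
     \<lparr>Obj = Q,
      Arr = {((X1, e1, Z1, m1, Y1), a, c, b, (X2, e2, Z2, m2, Y2)) | X1 e1 Z1 m1 Y1 a c b X2 e2 Z2 m2 Y2.
               (X1, e1, Z1, m1, Y1) \<in> Q \<and> (X2, e2, Z2, m2, Y2) \<in> Q \<and>
               a \<in> Hom C X1 X2 \<and> c \<in> Hom C Z1 Z2 \<and> b \<in> Hom C Y1 Y2 \<and>
               e2 \<cdot>\<^bsub>C\<^esub> a = c \<cdot>\<^bsub>C\<^esub> e1 \<and> m2 \<cdot>\<^bsub>C\<^esub> c = b \<cdot>\<^bsub>C\<^esub> m1},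
      Dom = (\<lambda>(F, a, c, b, F'). F),
      Cod = (\<lambda>(F, a, c, b, F'). F'),
      Id = (\<lambda>(X, e, Z, m, Y). ((X, e, Z, m, Y), Id C X, Id C Z, Id C Y, (X, e, Z, m, Y))),
      Comp = (\<lambda>(G, a', c', b', G') (F, a, c, b, F').
                (F, a' \<cdot>\<^bsub>C\<^esub> a, c' \<cdot>\<^bsub>C\<^esub> c, b' \<cdot>\<^bsub>C\<^esub> b, G'))\<rparr>)"

definition composition_functor ::
  "('o, 'm) cat \<Rightarrow> (('o, 'm) quintuple, ('o, 'm) quintuple \<times> 'm \<times> 'm \<times> 'm \<times> ('o, 'm) quintuple,
                     'm, 'm \<times> 'm \<times> 'm \<times> 'm) fctr" where
  "composition_functor C =
     (let K = (\<lambda>(X, e, Z, m, Y). m \<cdot>\<^bsub>C\<^esub> e)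
      in \<lparr>FObj = K, FArr = (\<lambda>(F, a, c, b, F'). (K F, a, b, K F'))\<rparr>)"


section \<open>Polar factorization\<close>

text \<open>\<open>polar_pair B g a b\<close>: at every stage, \<open>a\<close> is closed, \<open>b\<close> is open, and they correspond
  under \<open>g\<close>. In a partial order \<open>closed\<close> and \<open>open\<close> mean fixed by closure and interior, so
  these two conditions follow from the other two.\<close>

definition polar_pair :: "('o, 'm) cat \<Rightarrow> ('o, 'm) adj \<Rightarrow> 'm \<Rightarrow> 'm \<Rightarrow> bool" where
  "polar_pair B g a b \<longleftrightarrow>
     (radj g \<cdot>\<^bsub>B\<^esub> ladj g) \<cdot>\<^bsub>B\<^esub> a = a \<and> (ladj g \<cdot>\<^bsub>B\<^esub> radj g) \<cdot>\<^bsub>B\<^esub> b = b \<and>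
     a = radj g \<cdot>\<^bsub>B\<^esub> b \<and> b = ladj g \<cdot>\<^bsub>B\<^esub> a"

text \<open>The axis is the subobject \<open>{(a, b). polar_pair a b}\<close> of the product of the two carriers,
  given with its projections \<open>p\<close> and \<open>q\<close> and ordered componentwise.\<close>

definition is_axis ::
  "('o, 'm) cat \<Rightarrow> ('o, 'm) adj \<Rightarrow> ('o, 'm) iord \<times> 'm \<times> 'm \<Rightarrow> bool" where
  "is_axis B g = (\<lambda>(D, p, q).
     internal_partial_order B D \<and>
     p \<in> Hom B (carr D) (carr (asrc g)) \<and> q \<in> Hom B (carr D) (carr (atgt g)) \<and>
     polar_pair B g p q \<and>
     (\<forall>X. \<forall>a \<in> Hom B X (carr (asrc g)). \<forall>b \<in> Hom B X (carr (atgt g)). polar_pair B g a b \<longrightarrow>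
        (\<exists>!u. u \<in> Hom B X (carr D) \<and> p \<cdot>\<^bsub>B\<^esub> u = a \<and> q \<cdot>\<^bsub>B\<^esub> u = b)) \<and>
     (\<forall>X. \<forall>u \<in> Hom B X (carr D). \<forall>v \<in> Hom B X (carr D).
        ile B D u v \<longleftrightarrow>
          ile B (asrc g) (p \<cdot>\<^bsub>B\<^esub> u) (p \<cdot>\<^bsub>B\<^esub> v) \<and> ile B (atgt g) (q \<cdot>\<^bsub>B\<^esub> u) (q \<cdot>\<^bsub>B\<^esub> v)))"

text \<open>The axis is determined only up to isomorphism; one is chosen for each \<open>g\<close>.\<close>

definition axis :: "('o, 'm) cat \<Rightarrow> ('o, 'm) adj \<Rightarrow> ('o, 'm) iord \<times> 'm \<times> 'm" where
  "axis B g = (SOME D. is_axis B g D)"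

definition axis_pair :: "('o, 'm) cat \<Rightarrow> ('o, 'm) adj \<Rightarrow> 'm \<Rightarrow> 'm \<Rightarrow> 'm" where
  "axis_pair B g a b = (case axis B g of (D, p, q) \<Rightarrow>
     (THE u. u \<in> Hom B (Dom B a) (carr D) \<and> p \<cdot>\<^bsub>B\<^esub> u = a \<and> q \<cdot>\<^bsub>B\<^esub> u = b))"

text \<open>The left adjoint of the extent reflection sends \<open>a\<close> to its closure paired with its image;
  the right adjoint of the intent coreflection sends \<open>b\<close> to its image paired with its interior.
  The other two components are the projections.\<close>

definition extent :: "('o, 'm) cat \<Rightarrow> ('o, 'm) adj \<Rightarrow> ('o, 'm) adj" where
  "extent B g = (case axis B g of (D, p, q) \<Rightarrow>
     \<lparr>asrc = asrc g, atgt = D,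
      ladj = axis_pair B g (radj g \<cdot>\<^bsub>B\<^esub> ladj g) (ladj g), radj = p\<rparr>)"

definition intent :: "('o, 'm) cat \<Rightarrow> ('o, 'm) adj \<Rightarrow> ('o, 'm) adj" where
  "intent B g = (case axis B g of (D, p, q) \<Rightarrow>
     \<lparr>asrc = D, atgt = atgt g,
      ladj = q, radj = axis_pair B g (radj g) (ladj g \<cdot>\<^bsub>B\<^esub> radj g)\<rparr>)"

definition polar_factorization ::
  "('o, 'm) cat \<Rightarrow> ('o, 'm) adj \<Rightarrow> (('o, 'm) iord, ('o, 'm) adj) quintuple" where
  "polar_factorization B g = (asrc g, extent B g, fst (axis B g), intent B g, atgt g)"

text \<open>On morphisms the middle component is the unique diagonal between the two axes.\<close>

definition polar_functor ::
  "('o, 'm) cat \<Rightarrow>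
   (('o, 'm) adj, ('o, 'm) adj \<times> ('o, 'm) adj \<times> ('o, 'm) adj \<times> ('o, 'm) adj,
    (('o, 'm) iord, ('o, 'm) adj) quintuple,
    (('o, 'm) iord, ('o, 'm) adj) quintuple \<times> ('o, 'm) adj \<times> ('o, 'm) adj \<times> ('o, 'm) adj \<times>
      (('o, 'm) iord, ('o, 'm) adj) quintuple) fctr" where
  "polar_functor B =
     \<lparr>FObj = polar_factorization B,
      FArr = (\<lambda>(f, a, b, g).
        (polar_factorization B f, a,
         (THE c. c \<in> Hom (Adj B) (fst (axis B f)) (fst (axis B g)) \<and>
            extent B g \<cdot>\<^bsub>Adj B\<^esub> a = c \<cdot>\<^bsub>Adj B\<^esub> extent B f \<and>
            intent B g \<cdot>\<^bsub>Adj B\<^esub> c = b \<cdot>\<^bsub>Adj B\<^esub> intent B f),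
         b, polar_factorization B g))\<rparr>"

end

theory Submission
  imports Defs
begin

text \<open>A category with chosen factorizations and unique diagonal fillers between two classes of arrows
  has its arrow category equivalent to the category of factored arrows: factoring is functorial
  because middle components are fillers, and any factorization of a given arrow is isomorphic to
  the chosen one by a pair of mutually inverse fillers. It remains to see that the reflections and
  coreflections form such a system. The filler of a square from a reflection \<open>e\<close> to a
  coreflection \<open>m\<close>, with top \<open>u\<close> and bottom \<open>v\<close>, has left adjoint
  \<open>ladj u \<cdot> radj e = radj m \<cdot> ladj v\<close> and right adjoint
  \<open>ladj e \<cdot> radj u = radj v \<cdot> ladj m\<close>; one form of each yields the unit inequality, the
  other the counit. The axis exists because a topos has equalizers, and it factors the
  adjunction by the triangle identities, which are equations in partial orders.\<close>

section \<open>Factorization systems\<close>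

lemma Hom_iff: "f \<in> Hom C X Y \<longleftrightarrow> f \<in> Arr C \<and> Dom C f = X \<and> Cod C f = Y"
  by (simp add: Hom_def)

lemma is_functor_id: "category C \<Longrightarrow> is_functor C C fctr_id"
  by (simp add: is_functor_def fctr_id_def)

lemma is_functor_comp:
  assumes F: "is_functor C D F" and G: "is_functor D E G"
  shows "is_functor C E (fctr_comp G F)"
  unfolding is_functor_def
proof (intro conjI ballI allI)
  show "category C" "category E" using F G by (simp_all add: is_functor_def)
next
  fix X assume X: "X \<in> Obj C"
  have "FObj F X \<in> Obj D" "FArr F (Id C X) = Id D (FObj F X)"
    using F X by (simp_all add: is_functor_def)
  then show "FObj (fctr_comp G F) X \<in> Obj E"
    "FArr (fctr_comp G F) (Id C X) = Id E (FObj (fctr_comp G F) X)"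
    using G by (simp_all add: is_functor_def fctr_comp_def)
next
  fix X Y f assume "f \<in> Hom C X Y"
  then have "FArr F f \<in> Hom D (FObj F X) (FObj F Y)" using F by (simp add: is_functor_def)
  then show "FArr (fctr_comp G F) f \<in> Hom E (FObj (fctr_comp G F) X) (FObj (fctr_comp G F) Y)"
    using G by (simp add: is_functor_def fctr_comp_def)
next
  fix X Y Z f g assume f: "f \<in> Hom C X Y" and g: "g \<in> Hom C Y Z"
  then have "FArr F f \<in> Hom D (FObj F X) (FObj F Y)" "FArr F g \<in> Hom D (FObj F Y) (FObj F Z)"
    using F by (simp_all add: is_functor_def)
  then have "FArr G (FArr F g \<cdot>\<^bsub>D\<^esub> FArr F f) = FArr G (FArr F g) \<cdot>\<^bsub>E\<^esub> FArr G (FArr F f)"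
    using G unfolding is_functor_def by blast
  moreover have "FArr F (g \<cdot>\<^bsub>C\<^esub> f) = FArr F g \<cdot>\<^bsub>D\<^esub> FArr F f"
    using F f g unfolding is_functor_def by blast
  ultimately show "FArr (fctr_comp G F) (g \<cdot>\<^bsub>C\<^esub> f)
      = FArr (fctr_comp G F) g \<cdot>\<^bsub>E\<^esub> FArr (fctr_comp G F) f"
    by (simp add: fctr_comp_def)
qed

section \<open>Composition calculus and the arrow category\<close>

context category
begin

lemma id_arr [simp]: "X \<in> Obj C \<Longrightarrow> Id C X \<in> Arr C"
  and dom_id [simp]: "X \<in> Obj C \<Longrightarrow> Dom C (Id C X) = X"
  and cod_id [simp]: "X \<in> Obj C \<Longrightarrow> Cod C (Id C X) = X"
  using id_hom by (simp_all add: Hom_iff)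

text \<open>The middle object of \<open>comp_hom\<close> does not occur in its conclusion, which
  makes that axiom awkward as a rewrite rule. Stated through \<open>Arr\<close>, \<open>Dom\<close>
  and \<open>Cod\<close>, the premises mention only the two arrows themselves.\<close>

lemma comp_arr [simp]: "\<lbrakk>f \<in> Arr C; g \<in> Arr C; Dom C g = Cod C f\<rbrakk> \<Longrightarrow> g \<cdot> f \<in> Arr C"
  and dom_comp [simp]: "\<lbrakk>f \<in> Arr C; g \<in> Arr C; Dom C g = Cod C f\<rbrakk> \<Longrightarrow> Dom C (g \<cdot> f) = Dom C f"
  and cod_comp [simp]: "\<lbrakk>f \<in> Arr C; g \<in> Arr C; Dom C g = Cod C f\<rbrakk> \<Longrightarrow> Cod C (g \<cdot> f) = Cod C g"
  using comp_hom[of f "Dom C f" "Cod C f" g "Cod C g"] by (simp_all add: Hom_iff)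

lemma comp_id_arr [simp]: "\<lbrakk>f \<in> Arr C; Dom C f = X\<rbrakk> \<Longrightarrow> f \<cdot> Id C X = f"
  and id_comp_arr [simp]: "\<lbrakk>f \<in> Arr C; Cod C f = Y\<rbrakk> \<Longrightarrow> Id C Y \<cdot> f = f"
  using comp_id[of f "Dom C f" "Cod C f"] id_comp[of f "Dom C f" "Cod C f"] by (auto simp: Hom_iff)

lemma comp_assoc_arr:
  "\<lbrakk>f \<in> Arr C; g \<in> Arr C; h \<in> Arr C; Dom C g = Cod C f; Dom C h = Cod C g\<rbrakk>
    \<Longrightarrow> (h \<cdot> g) \<cdot> f = h \<cdot> (g \<cdot> f)"
  using comp_assoc by (simp add: Hom_iff)

lemma hom_obj:
  assumes "f \<in> Hom C X Y"
  shows "X \<in> Obj C" "Y \<in> Obj C"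
  using assms dom_obj cod_obj by (auto simp: Hom_iff)

lemma is_iso_id: "X \<in> Obj C \<Longrightarrow> is_iso C (Id C X)"
  unfolding is_iso_def by (auto intro!: bexI[of _ "Id C X"] simp: id_hom)

text \<open>Only closure under composition needs an argument: two commuting squares are pasted side
  by side. The remaining axioms hold componentwise.\<close>

lemma category_arrow_category: "category (arrow_category C)"
proof
  fix p q :: "'m \<times> 'm \<times> 'm \<times> 'm"
  fix X Y Z
  assume p: "p \<in> Hom (arrow_category C) X Y" and q: "q \<in> Hom (arrow_category C) Y Z"
  obtain a b where [simp]: "p = (X, a, b, Y)"
    using p by (cases p) (auto simp: Hom_iff arrow_category_def)
  obtain a' b' where [simp]: "q = (Y, a', b', Z)"
    using q by (cases q) (auto simp: Hom_iff arrow_category_def)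
  have A: "X \<in> Arr C" "Y \<in> Arr C" "Z \<in> Arr C"
      "a \<in> Arr C" "Dom C a = Dom C X" "Cod C a = Dom C Y"
      "b \<in> Arr C" "Dom C b = Cod C X" "Cod C b = Cod C Y"
      "a' \<in> Arr C" "Dom C a' = Dom C Y" "Cod C a' = Dom C Z"
      "b' \<in> Arr C" "Dom C b' = Cod C Y" "Cod C b' = Cod C Z"
    and sq: "Y \<cdot> a = b \<cdot> X" and sq': "Z \<cdot> a' = b' \<cdot> Y"
    using p q by (auto simp: Hom_iff arrow_category_def)
  have "Z \<cdot> (a' \<cdot> a) = (Z \<cdot> a') \<cdot> a" using A by (simp add: comp_assoc_arr)
  also have "\<dots> = b' \<cdot> (Y \<cdot> a)" using A by (simp add: comp_assoc_arr sq')
  also have "\<dots> = (b' \<cdot> b) \<cdot> X" using A by (simp add: comp_assoc_arr sq)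
  finally show "q \<cdot>\<^bsub>arrow_category C\<^esub> p \<in> Hom (arrow_category C) X Z"
    using A by (simp add: Hom_iff arrow_category_def)
qed (auto simp: Hom_iff arrow_category_def dom_obj cod_obj comp_assoc_arr)

section \<open>Factorization categories\<close>

lemma factorization_hom:
  "p \<in> Hom (factorization_category C E M) (X1, e1, Z1, m1, Y1) (X2, e2, Z2, m2, Y2) \<longleftrightarrow>
    e1 \<in> E \<and> e1 \<in> Hom C X1 Z1 \<and> m1 \<in> M \<and> m1 \<in> Hom C Z1 Y1 \<and>
    e2 \<in> E \<and> e2 \<in> Hom C X2 Z2 \<and> m2 \<in> M \<and> m2 \<in> Hom C Z2 Y2 \<and>
    (\<exists>a c b. p = ((X1, e1, Z1, m1, Y1), a, c, b, (X2, e2, Z2, m2, Y2)) \<and>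
      a \<in> Hom C X1 X2 \<and> c \<in> Hom C Z1 Z2 \<and> b \<in> Hom C Y1 Y2 \<and>
      e2 \<cdot> a = c \<cdot> e1 \<and> m2 \<cdot> c = b \<cdot> m1)"
  by (cases p) (auto simp: Hom_iff factorization_category_def)

lemma factorization_obj:
  "(X, e, Z, m, Y) \<in> Obj (factorization_category C E M) \<longleftrightarrow>
    e \<in> E \<and> e \<in> Hom C X Z \<and> m \<in> M \<and> m \<in> Hom C Z Y"
  by (auto simp: factorization_category_def)

text \<open>Serves the left and the right square of a composite of factored morphisms, and later the
  squares of a composite of fillers.\<close>

lemma square_paste:
  assumes "f \<in> Hom C X1 Y1" "g \<in> Hom C X2 Y2" "h \<in> Hom C X3 Y3"
    and "a \<in> Hom C X1 X2" "b \<in> Hom C Y1 Y2" "a' \<in> Hom C X2 X3" "b' \<in> Hom C Y2 Y3"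
    and "g \<cdot> a = b \<cdot> f" "h \<cdot> a' = b' \<cdot> g"
  shows "h \<cdot> (a' \<cdot> a) = (b' \<cdot> b) \<cdot> f"
proof -
  have "h \<cdot> (a' \<cdot> a) = (h \<cdot> a') \<cdot> a" using assms(1-7) by (simp add: comp_assoc_arr Hom_iff)
  also have "\<dots> = b' \<cdot> (g \<cdot> a)" using assms(1-7) by (simp add: assms comp_assoc_arr Hom_iff)
  also have "\<dots> = (b' \<cdot> b) \<cdot> f" using assms(1-7) by (simp add: assms comp_assoc_arr Hom_iff)
  finally show ?thesis .
qed

lemma factorization_simps [simp]:
  "Dom (factorization_category C E M) (F, a, c, b, G) = F"
  "Cod (factorization_category C E M) (F, a, c, b, G) = G"
  "Id (factorization_category C E M) (X, e, Z, m, Y) =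
    ((X, e, Z, m, Y), Id C X, Id C Z, Id C Y, (X, e, Z, m, Y))"
  "(G, a', c', b', H) \<cdot>\<^bsub>factorization_category C E M\<^esub> (F, a, c, b, G') =
    (F, a' \<cdot> a, c' \<cdot> c, b' \<cdot> b, H)"
  by (simp_all add: factorization_category_def)

lemma factorization_homE:
  assumes "p \<in> Hom (factorization_category C E M) F G"
  obtains X1 e1 Z1 m1 Y1 X2 e2 Z2 m2 Y2 a c b
  where "F = (X1, e1, Z1, m1, Y1)" "G = (X2, e2, Z2, m2, Y2)" "p = (F, a, c, b, G)"
    "e1 \<in> E" "e1 \<in> Hom C X1 Z1" "m1 \<in> M" "m1 \<in> Hom C Z1 Y1"
    "e2 \<in> E" "e2 \<in> Hom C X2 Z2" "m2 \<in> M" "m2 \<in> Hom C Z2 Y2"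
    "a \<in> Hom C X1 X2" "c \<in> Hom C Z1 Z2" "b \<in> Hom C Y1 Y2"
    "e2 \<cdot> a = c \<cdot> e1" "m2 \<cdot> c = b \<cdot> m1"
  using assms by (cases F, cases G) (auto simp: factorization_hom)

lemma category_factorization_category: "category (factorization_category C E M)"
proof
  let ?F = "factorization_category C E M"
  fix p assume "p \<in> Arr ?F"
  then have "p \<in> Hom ?F (Dom ?F p) (Cod ?F p)" by (simp add: Hom_iff)
  then show "Dom ?F p \<in> Obj ?F" "Cod ?F p \<in> Obj ?F"
    by (auto elim!: factorization_homE simp: factorization_obj)
next
  let ?F = "factorization_category C E M"
  fix X assume X: "X \<in> Obj ?F"
  obtain Y e Z m W where "X = (Y, e, Z, m, W)" by (metis prod_cases5)
  with X show "Id ?F X \<in> Hom ?F X X"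
    by (auto simp: factorization_obj factorization_hom Hom_iff[of _ C] dom_obj cod_obj)
next
  let ?F = "factorization_category C E M"
  fix p X Y assume "p \<in> Hom ?F X Y"
  then show "p \<cdot>\<^bsub>?F\<^esub> Id ?F X = p" "Id ?F Y \<cdot>\<^bsub>?F\<^esub> p = p"
    by (auto elim!: factorization_homE simp: comp_id id_comp)
next
  let ?F = "factorization_category C E M"
  fix p q r W X Y Z assume "p \<in> Hom ?F W X" "q \<in> Hom ?F X Y" "r \<in> Hom ?F Y Z"
  then show "(r \<cdot>\<^bsub>?F\<^esub> q) \<cdot>\<^bsub>?F\<^esub> p = r \<cdot>\<^bsub>?F\<^esub> (q \<cdot>\<^bsub>?F\<^esub> p)"
    by (elim factorization_homE) (simp add: comp_assoc)
next
  let ?F = "factorization_category C E M"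
  fix p q X Y Z assume p: "p \<in> Hom ?F X Y" and q: "q \<in> Hom ?F Y Z"
  from p show "q \<cdot>\<^bsub>?F\<^esub> p \<in> Hom ?F X Z"
  proof (rule factorization_homE)
    fix X1 e1 Z1 m1 Y1 X2 e2 Z2 m2 Y2 a c b
    assume P: "X = (X1, e1, Z1, m1, Y1)" "Y = (X2, e2, Z2, m2, Y2)" "p = (X, a, c, b, Y)"
      "e1 \<in> E" "e1 \<in> Hom C X1 Z1" "m1 \<in> M" "m1 \<in> Hom C Z1 Y1"
      "e2 \<in> E" "e2 \<in> Hom C X2 Z2" "m2 \<in> M" "m2 \<in> Hom C Z2 Y2"
      "a \<in> Hom C X1 X2" "c \<in> Hom C Z1 Z2" "b \<in> Hom C Y1 Y2"
      "e2 \<cdot> a = c \<cdot> e1" "m2 \<cdot> c = b \<cdot> m1"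
    obtain X3 e3 Z3 m3 Y3 where Z: "Z = (X3, e3, Z3, m3, Y3)" by (metis prod_cases5)
    from q obtain a' c' b' where Q: "q = (Y, a', c', b', Z)"
      "e3 \<in> E" "e3 \<in> Hom C X3 Z3" "m3 \<in> M" "m3 \<in> Hom C Z3 Y3"
      "a' \<in> Hom C X2 X3" "c' \<in> Hom C Z2 Z3" "b' \<in> Hom C Y2 Y3"
      "e3 \<cdot> a' = c' \<cdot> e2" "m3 \<cdot> c' = b' \<cdot> m2"
      unfolding P Z by (auto simp: factorization_hom)
    have "e3 \<cdot> (a' \<cdot> a) = (c' \<cdot> c) \<cdot> e1" using P Q by (intro square_paste[where g = e2])
    moreover have "m3 \<cdot> (c' \<cdot> c) = (b' \<cdot> b) \<cdot> m1" using P Q by (intro square_paste[where g = m2])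
    moreover have "a' \<cdot> a \<in> Hom C X1 X3" "c' \<cdot> c \<in> Hom C Z1 Z3" "b' \<cdot> b \<in> Hom C Y1 Y3"
      using P Q by (auto intro: comp_hom)
    moreover have "q \<cdot>\<^bsub>?F\<^esub> p = (X, a' \<cdot> a, c' \<cdot> c, b' \<cdot> b, Z)" by (simp add: P(3) Q(1))
    ultimately show ?thesis
      using P(4-7) Q(2-5) unfolding P(1) Z by (simp add: factorization_hom)
  qed
qed

end

text \<open>The factorization of each arrow is chosen by functions, since a functor has to be
  defined on every arrow. The equation \<open>u = d \<cdot> e\<close> in \<open>diagonal\<close> is
  oriented as in the squares of the factorization category, so fillers are middle components without
  any rewriting.\<close>

locale factorization_system = category C for C :: "('o, 'm) cat" (structure) +
  fixes E M :: "'m set" and l r :: "'m \<Rightarrow> 'm" and ax :: "'m \<Rightarrow> 'o"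
  assumes l_class: "f \<in> Arr C \<Longrightarrow> l f \<in> E" and r_class: "f \<in> Arr C \<Longrightarrow> r f \<in> M"
    and l_hom: "f \<in> Arr C \<Longrightarrow> l f \<in> Hom C (Dom C f) (ax f)"
    and r_hom: "f \<in> Arr C \<Longrightarrow> r f \<in> Hom C (ax f) (Cod C f)"
    and factors: "f \<in> Arr C \<Longrightarrow> r f \<cdot> l f = f"
    and diagonal: "\<lbrakk>e \<in> E; e \<in> Hom C X Z; m \<in> M; m \<in> Hom C Z' Y;
      u \<in> Hom C X Z'; v \<in> Hom C Z Y; m \<cdot> u = v \<cdot> e\<rbrakk>
      \<Longrightarrow> \<exists>!d. d \<in> Hom C Z Z' \<and> u = d \<cdot> e \<and> m \<cdot> d = v"
begin

section \<open>Fillers between factorizations\<close>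

definition factor :: "'m \<Rightarrow> ('o, 'm) quintuple" where
  "factor f = (Dom C f, l f, ax f, r f, Cod C f)"

text \<open>The description has the same shape as the middle component in
  \<open>polar_functor\<close>, so that the two functors agree by unfolding once \<open>C\<close> is
  \<open>Adj B\<close>.\<close>

definition filler :: "'m \<Rightarrow> 'm \<Rightarrow> 'm \<Rightarrow> 'm \<Rightarrow> 'm" where
  "filler f a b g = (THE c. c \<in> Hom C (ax f) (ax g) \<and> l g \<cdot> a = c \<cdot> l f \<and> r g \<cdot> c = b \<cdot> r f)"

definition factor_functor where
  "factor_functor = \<lparr>FObj = factor,
     FArr = (\<lambda>(f, a, b, g). (factor f, a, filler f a b g, b, factor g))\<rparr>"

abbreviation "A2 \<equiv> arrow_category C"
abbreviation "EM \<equiv> factorization_category C E M"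

text \<open>Both arrows fill the square with top \<open>c \<cdot> e\<close> and bottom
  \<open>m \<cdot> c\<close>, which commutes by associativity. This is the cancellation principle
  behind all later identities between middle components.\<close>

lemma diagonal_unique:
  assumes "e \<in> E" "e \<in> Hom C X Z" "m \<in> M" "m \<in> Hom C Z' Y"
    and "c \<in> Hom C Z Z'" "d \<in> Hom C Z Z'" "c \<cdot> e = d \<cdot> e" "m \<cdot> c = m \<cdot> d"
  shows "c = d"
proof -
  have "\<exists>!k. k \<in> Hom C Z Z' \<and> c \<cdot> e = k \<cdot> e \<and> m \<cdot> k = m \<cdot> c"
    using assms(1-6) by (intro diagonal[of _ X]) (auto simp: Hom_iff comp_assoc_arr)
  then show ?thesis using assms by metis
qed

text \<open>The outer square is regrouped as one from \<open>e\<close> to \<open>m'\<close>, with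
  top \<open>e' \<cdot> a\<close> and bottom \<open>b \<cdot> m\<close>. Neither factorization has
  to be a chosen one, so the result also serves to compare a given factorization with the chosen
  one.\<close>

lemma filler_between:
  assumes "e \<in> E" "e \<in> Hom C X Z" "m \<in> M" "m \<in> Hom C Z Y"
    and "e' \<in> E" "e' \<in> Hom C X' Z'" "m' \<in> M" "m' \<in> Hom C Z' Y'"
    and "a \<in> Hom C X X'" "b \<in> Hom C Y Y'" and sq: "(m' \<cdot> e') \<cdot> a = b \<cdot> (m \<cdot> e)"
  shows "\<exists>!c. c \<in> Hom C Z Z' \<and> e' \<cdot> a = c \<cdot> e \<and> m' \<cdot> c = b \<cdot> m"
proof -
  have "e' \<cdot> a \<in> Hom C X Z'" "b \<cdot> m \<in> Hom C Z Y'" using assms by (auto intro: comp_hom)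
  moreover have "m' \<cdot> (e' \<cdot> a) = (b \<cdot> m) \<cdot> e"
    using assms(1-10) sq by (simp add: Hom_iff comp_assoc_arr)
  ultimately show ?thesis using assms(1-10) by (intro diagonal)
qed

lemma arrow_hom:
  "p \<in> Hom A2 f g \<longleftrightarrow> f \<in> Arr C \<and> g \<in> Arr C \<and> (\<exists>a b. p = (f, a, b, g) \<and>
    a \<in> Hom C (Dom C f) (Dom C g) \<and> b \<in> Hom C (Cod C f) (Cod C g) \<and> g \<cdot> a = b \<cdot> f)"
  by (cases p) (auto simp: Hom_iff arrow_category_def)

lemma arrow_obj: "f \<in> Obj A2 \<longleftrightarrow> f \<in> Arr C"
  by (simp add: arrow_category_def)

lemma filler:
  assumes "(f, a, b, g) \<in> Hom A2 f g"
  shows "filler f a b g \<in> Hom C (ax f) (ax g)"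
    and "l g \<cdot> a = filler f a b g \<cdot> l f"
    and "r g \<cdot> filler f a b g = b \<cdot> r f"
proof -
  from assms have A: "f \<in> Arr C" "g \<in> Arr C" "a \<in> Hom C (Dom C f) (Dom C g)"
    "b \<in> Hom C (Cod C f) (Cod C g)" "g \<cdot> a = b \<cdot> f"
    by (auto simp: arrow_hom)
  have "\<exists>!c. c \<in> Hom C (ax f) (ax g) \<and> l g \<cdot> a = c \<cdot> l f \<and> r g \<cdot> c = b \<cdot> r f"
    using A by (intro filler_between[OF l_class l_hom r_class r_hom l_class l_hom r_class r_hom])
      (simp_all add: factors)
  from theI'[OF this] show "filler f a b g \<in> Hom C (ax f) (ax g)"
    and "l g \<cdot> a = filler f a b g \<cdot> l f" and "r g \<cdot> filler f a b g = b \<cdot> r f"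
    unfolding filler_def by auto
qed

text \<open>Functoriality rests on this: identities and composites of fillers satisfy the two
  equations that characterise the filler of the identity square and of the pasted square.\<close>

lemma filler_eqI:
  assumes "(f, a, b, g) \<in> Hom A2 f g" and "c \<in> Hom C (ax f) (ax g)"
    and "l g \<cdot> a = c \<cdot> l f" and "r g \<cdot> c = b \<cdot> r f"
  shows "filler f a b g = c"
proof -
  have "f \<in> Arr C" "g \<in> Arr C" using assms(1) by (auto simp: arrow_hom)
  then show ?thesis
    using filler[OF assms(1)] assms
    by - (rule diagonal_unique[OF l_class l_hom r_class r_hom, of f g _ c], simp_all)
qed

section \<open>Factorization as a functor\<close>

lemma is_functor_factor: "is_functor A2 EM factor_functor"
  unfolding is_functor_def
proof (intro conjI ballI allI)
  show "category A2" by (rule category_arrow_category)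
  show "category EM" by (rule category_factorization_category)
next
  fix f assume "f \<in> Obj A2"
  then have f: "f \<in> Arr C" by (simp add: arrow_obj)
  then show "FObj factor_functor f \<in> Obj EM"
    by (simp add: factor_functor_def factor_def factorization_obj l_class r_class l_hom r_hom)
  have hom: "(f, Id C (Dom C f), Id C (Cod C f), f) \<in> Hom A2 f f"
    using f by (simp add: arrow_hom id_hom dom_obj cod_obj)
  have "filler f (Id C (Dom C f)) (Id C (Cod C f)) f = Id C (ax f)"
    using l_hom[OF f] r_hom[OF f] hom_obj[OF l_hom[OF f]]
    by (intro filler_eqI[OF hom]) (simp_all add: Hom_iff)
  then show "FArr factor_functor (Id A2 f) = Id EM (FObj factor_functor f)"
    by (simp add: arrow_category_def factorization_category_def factor_functor_def factor_def)
next
  fix f g p assume "p \<in> Hom A2 f g"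
  moreover from this obtain a b where "p = (f, a, b, g)" by (auto simp: arrow_hom)
  moreover note filler
  ultimately show "FArr factor_functor p \<in> Hom EM (FObj factor_functor f) (FObj factor_functor g)"
    by (simp add: arrow_hom factor_functor_def factor_def factorization_hom
        l_class r_class l_hom r_hom)
next
  fix f g h p q assume p: "p \<in> Hom A2 f g" and q: "q \<in> Hom A2 g h"
  obtain a b where [simp]: "p = (f, a, b, g)" using p by (auto simp: arrow_hom)
  obtain a' b' where [simp]: "q = (g, a', b', h)" using q by (auto simp: arrow_hom)
  have qp: "q \<cdot>\<^bsub>A2\<^esub> p = (f, a' \<cdot> a, b' \<cdot> b, h)" by (simp add: arrow_category_def)
  have hom: "(f, a' \<cdot> a, b' \<cdot> b, h) \<in> Hom A2 f h"
    using category.comp_hom[OF category_arrow_category p q] by (simp only: qp)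
  have P: "f \<in> Arr C" "g \<in> Arr C" "h \<in> Arr C" "a \<in> Hom C (Dom C f) (Dom C g)"
    "b \<in> Hom C (Cod C f) (Cod C g)" "a' \<in> Hom C (Dom C g) (Dom C h)"
    "b' \<in> Hom C (Cod C g) (Cod C h)"
    using p q by (auto simp: arrow_hom)
  note cp = filler[OF p[unfolded \<open>p = _\<close>]] and cq = filler[OF q[unfolded \<open>q = _\<close>]]
  have "filler f (a' \<cdot> a) (b' \<cdot> b) h = filler g a' b' h \<cdot> filler f a b g"
  proof (rule filler_eqI[OF hom])
    show "filler g a' b' h \<cdot> filler f a b g \<in> Hom C (ax f) (ax h)"
      using cp(1) cq(1) by (rule comp_hom)
    show "l h \<cdot> (a' \<cdot> a) = (filler g a' b' h \<cdot> filler f a b g) \<cdot> l f"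
      using P cp cq by (intro square_paste[OF l_hom l_hom l_hom])
    show "r h \<cdot> (filler g a' b' h \<cdot> filler f a b g) = (b' \<cdot> b) \<cdot> r f"
      using P cp cq by (intro square_paste[OF r_hom r_hom r_hom])
  qed
  then show "FArr factor_functor (q \<cdot>\<^bsub>A2\<^esub> p) = FArr factor_functor q \<cdot>\<^bsub>EM\<^esub> FArr factor_functor p"
    unfolding qp by (simp add: factor_functor_def factorization_category_def)
qed

section \<open>Composition as a functor\<close>

lemma composition_functor_simps [simp]:
  "FObj (composition_functor C) (X, e, Z, m, Y) = m \<cdot> e"
  "FArr (composition_functor C) (F, a, c, b, G) =
    (FObj (composition_functor C) F, a, b, FObj (composition_functor C) G)"
  by (simp_all add: composition_functor_def Let_def)

lemma is_functor_composition: "is_functor EM A2 (composition_functor C)"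
  unfolding is_functor_def
proof (intro conjI ballI allI)
  show "category A2" by (rule category_arrow_category)
  show "category EM" by (rule category_factorization_category)
next
  fix F assume F: "F \<in> Obj EM"
  obtain X e Z m Y where [simp]: "F = (X, e, Z, m, Y)" by (metis prod_cases5)
  from F have "e \<in> Hom C X Z" "m \<in> Hom C Z Y" by (simp_all add: factorization_obj)
  then show "FObj (composition_functor C) F \<in> Obj A2"
    and "FArr (composition_functor C) (Id EM F) = Id A2 (FObj (composition_functor C) F)"
    by (auto simp: arrow_category_def factorization_category_def Hom_iff)
next
  fix F G p assume p: "p \<in> Hom EM F G"
  obtain X e Z m Y X' e' Z' m' Y' where [simp]: "F = (X, e, Z, m, Y)" "G = (X', e', Z', m', Y')"
    by (metis prod_cases5)
  from p obtain a c b where [simp]: "p = (F, a, c, b, G)" and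
    P: "e \<in> Hom C X Z" "m \<in> Hom C Z Y" "e' \<in> Hom C X' Z'" "m' \<in> Hom C Z' Y'"
    "a \<in> Hom C X X'" "c \<in> Hom C Z Z'" "b \<in> Hom C Y Y'" and sq: "e' \<cdot> a = c \<cdot> e" "m' \<cdot> c = b \<cdot> m"
    by (auto simp: factorization_hom)
  \<comment> \<open>The two squares share the side \<open>c\<close>; pasting along it gives the
    outer square, in which \<open>c\<close> is forgotten.\<close>
  have "(m' \<cdot> e') \<cdot> a = m' \<cdot> (e' \<cdot> a)" using P by (simp add: Hom_iff comp_assoc_arr)
  also have "\<dots> = (m' \<cdot> c) \<cdot> e" using P by (simp add: sq(1) Hom_iff comp_assoc_arr)
  also have "\<dots> = b \<cdot> (m \<cdot> e)" using P by (simp add: sq(2) Hom_iff comp_assoc_arr)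
  finally show "FArr (composition_functor C) p
      \<in> Hom A2 (FObj (composition_functor C) F) (FObj (composition_functor C) G)"
    using P by (simp add: arrow_hom) (simp add: Hom_iff)
next
  fix F G H p q assume p: "p \<in> Hom EM F G" and q: "q \<in> Hom EM G H"
  obtain a c b where [simp]: "p = (F, a, c, b, G)"
    using p by (cases F, cases G) (auto simp: factorization_hom)
  obtain a' c' b' where [simp]: "q = (G, a', c', b', H)"
    using q by (cases G, cases H) (auto simp: factorization_hom)
  show "FArr (composition_functor C) (q \<cdot>\<^bsub>EM\<^esub> p)
      = FArr (composition_functor C) q \<cdot>\<^bsub>A2\<^esub> FArr (composition_functor C) p"
    by (simp add: arrow_category_def factorization_category_def)
qed

section \<open>The two natural isomorphisms of the equivalence\<close>

lemma natural_iso_arrow: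
  "naturally_isomorphic A2 A2 fctr_id (fctr_comp (composition_functor C) factor_functor)"
proof -
  interpret A2: category A2 by (rule category_arrow_category)
  let ?G = "fctr_comp (composition_functor C) factor_functor"
  \<comment> \<open>By \<open>factors\<close>, factoring and then composing returns the arrow
    itself, and a square keeps its outer components. The composite thus acts as the identity
    functor, and identities can be taken as the isomorphism.\<close>
  have obj: "FObj ?G f = f" if "f \<in> Arr C" for f
    using that by (simp add: fctr_comp_def factor_functor_def factor_def factors)
  have arr: "FArr ?G p = p" if "p \<in> Hom A2 f g" for f g p
    using that by (auto simp: arrow_hom fctr_comp_def factor_functor_def factor_def factors)
  show ?thesis
    unfolding naturally_isomorphic_def
  proof (intro conjI exI[of _ "Id A2"] ballI allI)
    show "is_functor A2 A2 fctr_id" by (rule is_functor_id) (rule category_arrow_category)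
    show "is_functor A2 A2 ?G" by (rule is_functor_comp[OF is_functor_factor is_functor_composition])
  next
    fix f assume f: "f \<in> Obj A2"
    then show "Id A2 f \<in> Hom A2 (FObj fctr_id f) (FObj ?G f)" "is_iso A2 (Id A2 f)"
      using A2.id_hom A2.is_iso_id by (simp_all add: obj arrow_obj fctr_id_def)
  next
    fix f g p assume p: "p \<in> Hom A2 f g"
    then show "FArr ?G p \<cdot>\<^bsub>A2\<^esub> Id A2 f = Id A2 g \<cdot>\<^bsub>A2\<^esub> FArr fctr_id p"
      by (simp add: arr[OF p] fctr_id_def A2.comp_id A2.id_comp)
  qed
qed

text \<open>The middle component fills the square with identities on the outside. Its description is
  written out because \<open>filler\<close> only joins two chosen factorizations, while here the
  target is arbitrary.\<close>

definition comparison ::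
  "('o, 'm) quintuple \<Rightarrow> ('o, 'm) quintuple \<times> 'm \<times> 'm \<times> 'm \<times> ('o, 'm) quintuple" where
  "comparison = (\<lambda>(X, e, Z, m, Y). (factor (m \<cdot> e), Id C X,
     (THE c. c \<in> Hom C (ax (m \<cdot> e)) Z \<and> e \<cdot> Id C X = c \<cdot> l (m \<cdot> e) \<and> m \<cdot> c = Id C Y \<cdot> r (m \<cdot> e)),
     Id C Y, (X, e, Z, m, Y)))"

text \<open>Two factorizations of the same arrow have a filler in each direction. Both composites of
  these fillers satisfy the equations of an identity, so \<open>diagonal_unique\<close> makes the
  fillers mutually inverse.\<close>

lemma comparison:
  assumes "(X, e, Z, m, Y) \<in> Obj EM"
  obtains c where "comparison (X, e, Z, m, Y) = (factor (m \<cdot> e), Id C X, c, Id C Y, (X, e, Z, m, Y))"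
    "c \<in> Hom C (ax (m \<cdot> e)) Z" "c \<cdot> l (m \<cdot> e) = e" "m \<cdot> c = r (m \<cdot> e)"
    "is_iso EM (comparison (X, e, Z, m, Y))"
proof -
  have E: "e \<in> E" "e \<in> Hom C X Z" "m \<in> M" "m \<in> Hom C Z Y"
    using assms by (simp_all add: factorization_obj)
  note obj = hom_obj[OF E(2)] hom_obj[OF E(4)]
  define f where "f = m \<cdot> e"
  have f: "f \<in> Arr C" "Dom C f = X" "Cod C f = Y"
    using E by (simp_all add: f_def Hom_iff)
  note L = l_class[OF f(1)] l_hom[OF f(1), unfolded f] r_class[OF f(1)] r_hom[OF f(1), unfolded f]
  have fac: "r f \<cdot> l f = m \<cdot> e" using factors[OF f(1)] by (simp add: f_def)
  have arr: "m \<cdot> e \<in> Arr C" "Dom C (m \<cdot> e) = X" "Cod C (m \<cdot> e) = Y" using f by (simp_all add: f_def)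
  have ex: "\<exists>!c. c \<in> Hom C (ax f) Z \<and> e \<cdot> Id C X = c \<cdot> l f \<and> m \<cdot> c = Id C Y \<cdot> r f"
    using L E arr id_hom[OF obj(1)] id_hom[OF obj(4)] by (intro filler_between) (simp_all add: fac)
  define c where "c = (THE c. c \<in> Hom C (ax f) Z \<and> e \<cdot> Id C X = c \<cdot> l f \<and> m \<cdot> c = Id C Y \<cdot> r f)"
  have c: "c \<in> Hom C (ax f) Z" "c \<cdot> l f = e" "m \<cdot> c = r f"
    using theI'[OF ex, folded c_def] comp_id[OF E(2)] id_comp[OF L(4)] by simp_all
  \<comment> \<open>The filler in the opposite direction is the candidate for the inverse of
    \<open>c\<close>.\<close>
  have "\<exists>!d. d \<in> Hom C Z (ax f) \<and> l f \<cdot> Id C X = d \<cdot> e \<and> r f \<cdot> d = Id C Y \<cdot> m"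
    using L E arr id_hom[OF obj(1)] id_hom[OF obj(4)] by (intro filler_between) (simp_all add: fac)
  then obtain d where "d \<in> Hom C Z (ax f) \<and> l f \<cdot> Id C X = d \<cdot> e \<and> r f \<cdot> d = Id C Y \<cdot> m"
    by blast
  then have d: "d \<in> Hom C Z (ax f)" "d \<cdot> e = l f" "r f \<cdot> d = m"
    using E L by (auto simp: Hom_iff)
  have dc: "d \<cdot> c = Id C (ax f)"
  proof (rule diagonal_unique[OF L])
    show "d \<cdot> c \<in> Hom C (ax f) (ax f)" using c d by (auto intro: comp_hom)
    show "Id C (ax f) \<in> Hom C (ax f) (ax f)" using hom_obj[OF c(1)] by (simp add: id_hom)
    show "(d \<cdot> c) \<cdot> l f = Id C (ax f) \<cdot> l f"
      using c d L(2) by (simp add: comp_assoc[OF L(2) c(1) d(1)] id_comp)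
    show "r f \<cdot> d \<cdot> c = r f \<cdot> Id C (ax f)"
      using c d L(4) by (simp add: comp_assoc[OF c(1) d(1) L(4), symmetric] comp_id)
  qed
  have cd: "c \<cdot> d = Id C Z"
  proof (rule diagonal_unique[OF E])
    show "c \<cdot> d \<in> Hom C Z Z" using c d by (auto intro: comp_hom)
    show "Id C Z \<in> Hom C Z Z" using obj by (simp add: id_hom)
    show "(c \<cdot> d) \<cdot> e = Id C Z \<cdot> e"
      using c d E by (simp add: comp_assoc[OF E(2) d(1) c(1)] id_comp)
    show "m \<cdot> c \<cdot> d = m \<cdot> Id C Z"
      using c d E by (simp add: comp_assoc[OF d(1) c(1) E(4), symmetric] comp_id)
  qed
  let ?F = "(X, e, Z, m, Y)"
  have comparison: "comparison ?F = (factor f, Id C X, c, Id C Y, ?F)"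
    by (simp add: comparison_def c_def f_def)
  have fwd: "(factor f, Id C X, c, Id C Y, ?F) \<in> Hom EM (factor f) ?F"
    using L E obj c by (simp add: factor_def f factorization_hom id_hom comp_id id_comp)
  have bwd: "(?F, Id C X, d, Id C Y, factor f) \<in> Hom EM ?F (factor f)"
    using L E obj d by (simp add: factor_def f factorization_hom id_hom comp_id id_comp)
  have "is_iso EM (comparison ?F)"
    unfolding is_iso_def comparison
  proof (intro conjI bexI[of _ "(?F, Id C X, d, Id C Y, factor f)"])
    show "(factor f, Id C X, c, Id C Y, ?F) \<in> Arr EM" using fwd by (simp add: Hom_iff)
  qed (use bwd obj in \<open>simp_all add: cd dc\<close>, simp add: factor_def f)
  then show ?thesis using that comparison c by (simp add: f_def)
qed

text \<open>The outer components of \<open>comparison\<close> are identities, so naturality is a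
  single equation between middle components.\<close>

lemma natural_iso_factorization:
  "naturally_isomorphic EM EM (fctr_comp factor_functor (composition_functor C)) fctr_id"
  unfolding naturally_isomorphic_def
proof (intro conjI exI[of _ comparison] ballI allI)
  let ?G = "fctr_comp factor_functor (composition_functor C)"
  show "is_functor EM EM fctr_id" by (rule is_functor_id) (rule category_factorization_category)
  show "is_functor EM EM ?G" by (rule is_functor_comp[OF is_functor_composition is_functor_factor])
  fix F assume F: "F \<in> Obj EM"
  obtain X e Z m Y where F_eq: "F = (X, e, Z, m, Y)" by (metis prod_cases5)
  from comparison[OF F[unfolded F_eq]] obtain c where
    c: "comparison F = (factor (m \<cdot> e), Id C X, c, Id C Y, F)" and iso: "is_iso EM (comparison F)"
    unfolding F_eq by metis
  show "is_iso EM (comparison F)" by (fact iso)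
  then show "comparison F \<in> Hom EM (FObj ?G F) (FObj fctr_id F)"
    by (simp add: is_iso_def Hom_iff c) (simp add: F_eq fctr_comp_def factor_functor_def fctr_id_def)
next
  let ?G = "fctr_comp factor_functor (composition_functor C)"
  fix F F' p assume p: "p \<in> Hom EM F F'"
  then obtain X e Z m Y X' e' Z' m' Y' a b c where
    F: "F = (X, e, Z, m, Y)" and F': "F' = (X', e', Z', m', Y')" and p_eq: "p = (F, a, c, b, F')"
    and E: "e \<in> E" "e \<in> Hom C X Z" "m \<in> M" "m \<in> Hom C Z Y"
      "e' \<in> E" "e' \<in> Hom C X' Z'" "m' \<in> M" "m' \<in> Hom C Z' Y'"
    and abc: "a \<in> Hom C X X'" "c \<in> Hom C Z Z'" "b \<in> Hom C Y Y'" "e' \<cdot> a = c \<cdot> e" "m' \<cdot> c = b \<cdot> m"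
    by (rule factorization_homE)
  define f f' where "f = m \<cdot> e" and "f' = m' \<cdot> e'"
  have f: "f \<in> Arr C" "Dom C f = X" "Cod C f = Y" "f' \<in> Arr C" "Dom C f' = X'" "Cod C f' = Y'"
    using E by (simp_all add: f_def f'_def Hom_iff)
  note L = l_class[OF f(1)] l_hom[OF f(1), unfolded f] r_class[OF f(1)] r_hom[OF f(1), unfolded f]
  note L' = l_class[OF f(4)] l_hom[OF f(4), unfolded f] r_class[OF f(4)] r_hom[OF f(4), unfolded f]
  obtain k where k: "comparison F = (factor f, Id C X, k, Id C Y, F)"
    "k \<in> Hom C (ax f) Z" "k \<cdot> l f = e" "m \<cdot> k = r f"
    using comparison[of X e Z m Y] E unfolding F f_def by (metis factorization_obj)
  obtain k' where k': "comparison F' = (factor f', Id C X', k', Id C Y', F')"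
    "k' \<in> Hom C (ax f') Z'" "k' \<cdot> l f' = e'" "m' \<cdot> k' = r f'"
    using comparison[of X' e' Z' m' Y'] E unfolding F' f'_def by (metis factorization_obj)
  let ?d = "filler f a b f'"
  \<comment> \<open>Functoriality of composition supplies the commuting outer square that
    \<open>filler\<close> requires.\<close>
  have sq: "(f, a, b, f') \<in> Hom A2 f f'"
    using is_functor_composition p unfolding is_functor_def p_eq F F' f_def f'_def by fastforce
  note d = filler[OF sq]
  \<comment> \<open>Before the reflection-like part \<open>l f\<close> both sides become
    \<open>e' \<cdot> a\<close>, and followed by \<open>m'\<close> both become
    \<open>b \<cdot> r f\<close>.\<close>
  have "c \<cdot> k = k' \<cdot> ?d"
  proof (rule diagonal_unique[OF L(1,2) E(7,8)])
    show "c \<cdot> k \<in> Hom C (ax f) Z'" "k' \<cdot> ?d \<in> Hom C (ax f) Z'"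
      using abc k k' d by (auto intro: comp_hom)
    have "(k' \<cdot> ?d) \<cdot> l f = (k' \<cdot> l f') \<cdot> a"
      by (simp only: comp_assoc[OF L(2) d(1) k'(2)] comp_assoc[OF abc(1) L'(2) k'(2)] d(2))
    then show "(c \<cdot> k) \<cdot> l f = (k' \<cdot> ?d) \<cdot> l f"
      by (simp add: comp_assoc[OF L(2) k(2) abc(2)] k(3) k'(3) abc(4))
    have "m' \<cdot> (c \<cdot> k) = b \<cdot> (m \<cdot> k)"
      by (simp only: comp_assoc[OF k(2) abc(2) E(8), symmetric] comp_assoc[OF k(2) E(4) abc(3), symmetric]
          abc(5))
    then show "m' \<cdot> (c \<cdot> k) = m' \<cdot> (k' \<cdot> ?d)"
      by (simp add: comp_assoc[OF d(1) k'(2) E(8), symmetric] k(4) k'(4) d(3))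
  qed
  moreover have "FArr ?G p = (factor f, a, ?d, b, factor f')"
    by (simp add: fctr_comp_def factor_functor_def p_eq F F' f_def f'_def)
  ultimately show "FArr fctr_id p \<cdot>\<^bsub>EM\<^esub> comparison F = comparison F' \<cdot>\<^bsub>EM\<^esub> FArr ?G p"
    using abc by (simp add: fctr_id_def k(1) k'(1) p_eq comp_id id_comp)
qed

theorem equivalence_arrow_factorization:
  "equivalence_of_categories A2 EM factor_functor (composition_functor C)"
  unfolding equivalence_of_categories_def
  by (intro conjI is_functor_factor is_functor_composition natural_iso_arrow
      natural_iso_factorization)

end

section \<open>Internal orders and adjunctions\<close>

context category
begin

lemma monotonic_hom: "monotonic C A0 A1 f \<Longrightarrow> f \<in> Hom C (carr A0) (carr A1)"
  by (simp add: monotonic_def)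

lemma monotonicD:
  "\<lbrakk>monotonic C A0 A1 f; u \<in> Hom C X (carr A0); v \<in> Hom C X (carr A0); ile C A0 u v\<rbrakk>
    \<Longrightarrow> ile C A1 (f \<cdot> u) (f \<cdot> v)"
  by (auto simp: monotonic_def)

lemma monotonic_comp:
  assumes f: "monotonic C A0 A1 f" and g: "monotonic C A1 A2 g"
  shows "monotonic C A0 A2 (g \<cdot> f)"
  unfolding monotonic_def
proof (intro conjI allI ballI impI)
  note hom = monotonic_hom[OF f] monotonic_hom[OF g]
  show "g \<cdot> f \<in> Hom C (carr A0) (carr A2)" using hom by (rule comp_hom)
  fix X u v assume uv: "u \<in> Hom C X (carr A0)" "v \<in> Hom C X (carr A0)" "ile C A0 u v"
  have "ile C A2 (g \<cdot> (f \<cdot> u)) (g \<cdot> (f \<cdot> v))"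
    using uv hom by (intro monotonicD[OF g] monotonicD[OF f]) (auto intro: comp_hom)
  then show "ile C A2 ((g \<cdot> f) \<cdot> u) ((g \<cdot> f) \<cdot> v)"
    using uv hom by (simp add: comp_assoc)
qed

lemma monotonic_id: "carr A \<in> Obj C \<Longrightarrow> monotonic C A A (Id C (carr A))"
  by (auto simp: monotonic_def id_hom id_comp)

lemma partial_order_carr: "internal_partial_order C A \<Longrightarrow> carr A \<in> Obj C"
  unfolding internal_partial_order_def internal_preorder_def internal_relation_def
  using hom_obj(2) by blast

lemma ile_refl: "\<lbrakk>internal_partial_order C A; u \<in> Hom C X (carr A)\<rbrakk> \<Longrightarrow> ile C A u u"
  by (auto simp: internal_partial_order_def internal_preorder_def)

lemma ile_trans:
  assumes "internal_partial_order C A" "u \<in> Hom C X (carr A)" "v \<in> Hom C X (carr A)"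
    "w \<in> Hom C X (carr A)" "ile C A u v" "ile C A v w"
  shows "ile C A u w"
  using assms unfolding internal_partial_order_def internal_preorder_def by blast

lemma ile_antisym:
  assumes "internal_partial_order C A" "u \<in> Hom C X (carr A)" "v \<in> Hom C X (carr A)"
    "ile C A u v" "ile C A v u"
  shows "u = v"
  using assms unfolding internal_partial_order_def by blast

text \<open>The order is stable under change of stage: the arrow into \<open>rel A\<close> that
  witnesses the inequality is precomposed with \<open>w\<close>.\<close>

lemma ile_comp:
  assumes "internal_partial_order C A" "u \<in> Hom C X (carr A)" "w \<in> Hom C W X" "ile C A u v"
  shows "ile C A (u \<cdot> w) (v \<cdot> w)"
proof -
  have r: "fstp A \<in> Hom C (rel A) (carr A)" "sndp A \<in> Hom C (rel A) (carr A)"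
    using assms(1)
    by (simp_all add: internal_partial_order_def internal_preorder_def internal_relation_def)
  obtain h where h: "h \<in> Hom C X (rel A)" "fstp A \<cdot> h = u" "sndp A \<cdot> h = v"
    using assms(2,4) by (auto simp: ile_def Hom_iff)
  have "h \<cdot> w \<in> Hom C W (rel A)" using assms(3) h(1) by (rule comp_hom)
  moreover have "fstp A \<cdot> (h \<cdot> w) = u \<cdot> w" "sndp A \<cdot> (h \<cdot> w) = v \<cdot> w"
    using comp_assoc[OF assms(3) h(1) r(1)] comp_assoc[OF assms(3) h(1) r(2)] h(2,3) by simp_all
  moreover have "Dom C (u \<cdot> w) = W" using comp_hom[OF assms(3,2)] by (simp add: Hom_iff)
  ultimately show ?thesis unfolding ile_def by auto
qed

section \<open>The category of internal partial orders and adjunctions\<close>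

lemma Adj_simps [simp]:
  "Obj (Adj C) = {A. internal_partial_order C A}"
  "Dom (Adj C) = asrc" "Cod (Adj C) = atgt"
  "asrc (Id (Adj C) A) = A" "atgt (Id (Adj C) A) = A"
  "ladj (Id (Adj C) A) = Id C (carr A)" "radj (Id (Adj C) A) = Id C (carr A)"
  "asrc (h \<cdot>\<^bsub>Adj C\<^esub> g) = asrc g" "atgt (h \<cdot>\<^bsub>Adj C\<^esub> g) = atgt h"
  "ladj (h \<cdot>\<^bsub>Adj C\<^esub> g) = ladj h \<cdot> ladj g" "radj (h \<cdot>\<^bsub>Adj C\<^esub> g) = radj g \<cdot> radj h"
  by (simp_all add: Adj_def)

lemma Adj_hom:
  "g \<in> Hom (Adj C) A0 A1 \<longleftrightarrow> asrc g = A0 \<and> atgt g = A1 \<and>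
    internal_partial_order C A0 \<and> internal_partial_order C A1 \<and>
    monotonic C A0 A1 (ladj g) \<and> monotonic C A1 A0 (radj g) \<and>
    ile C A0 (Id C (carr A0)) (radj g \<cdot> ladj g) \<and> ile C A1 (ladj g \<cdot> radj g) (Id C (carr A1))"
  by (auto simp: Hom_def Adj_def order_adjunction_def)

lemma Adj_arr: "g \<in> Arr (Adj C) \<longleftrightarrow> g \<in> Hom (Adj C) (asrc g) (atgt g)"
  by (simp add: Hom_def)

lemma adj_eqI:
  fixes g h :: "('x, 'y) adj"
  assumes "asrc g = asrc h" "atgt g = atgt h" "ladj g = ladj h" "radj g = radj h"
  shows "g = h"
  using assms by simp

lemma ladj_hom: "g \<in> Hom (Adj C) A0 A1 \<Longrightarrow> ladj g \<in> Hom C (carr A0) (carr A1)"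
  and radj_hom: "g \<in> Hom (Adj C) A0 A1 \<Longrightarrow> radj g \<in> Hom C (carr A1) (carr A0)"
  by (auto simp: Adj_hom monotonic_hom)

text \<open>The unit inequality moved to stage \<open>X\<close> by \<open>ile_comp\<close>. The
  bracketing to the right is the form to which \<open>monotonicD\<close> applies.\<close>

lemma Adj_unit:
  assumes g: "g \<in> Hom (Adj C) A0 A1" and u: "u \<in> Hom C X (carr A0)"
  shows "ile C A0 u (radj g \<cdot> (ladj g \<cdot> u))"
proof -
  have A0: "internal_partial_order C A0" and le: "ile C A0 (Id C (carr A0)) (radj g \<cdot> ladj g)"
    using g by (auto simp: Adj_hom)
  show ?thesis
    using ile_comp[OF A0 id_hom[OF partial_order_carr[OF A0]] u le] ladj_hom[OF g] radj_hom[OF g] u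
    by (simp add: comp_assoc id_comp)
qed

lemma Adj_counit:
  assumes g: "g \<in> Hom (Adj C) A0 A1" and u: "u \<in> Hom C X (carr A1)"
  shows "ile C A1 (ladj g \<cdot> (radj g \<cdot> u)) u"
proof -
  have A1: "internal_partial_order C A1" and le: "ile C A1 (ladj g \<cdot> radj g) (Id C (carr A1))"
    using g by (auto simp: Adj_hom)
  show ?thesis
    using ile_comp[OF A1 comp_hom[OF radj_hom[OF g] ladj_hom[OF g]] u le]
      ladj_hom[OF g] radj_hom[OF g] u
    by (simp add: comp_assoc id_comp)
qed

lemma Adj_homI:
  assumes A: "internal_partial_order C A0" "internal_partial_order C A1"
    and mono: "monotonic C A0 A1 f" "monotonic C A1 A0 g"
    and le: "ile C A0 (Id C (carr A0)) (g \<cdot> f)" "ile C A1 (f \<cdot> g) (Id C (carr A1))"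
  shows "\<lparr>asrc = A0, atgt = A1, ladj = f, radj = g\<rparr> \<in> Hom (Adj C) A0 A1"
  using assms by (simp add: Adj_hom)

lemma category_Adj: "category (Adj C)"
proof
  fix f assume "f \<in> Arr (Adj C)"
  then show "Dom (Adj C) f \<in> Obj (Adj C)" "Cod (Adj C) f \<in> Obj (Adj C)"
    by (simp_all add: Adj_arr Adj_hom)
next
  fix A assume A: "A \<in> Obj (Adj C)"
  then show "Id (Adj C) A \<in> Hom (Adj C) A A"
    using partial_order_carr[of A] id_hom[of "carr A"]
    by (simp add: Adj_hom monotonic_id ile_refl id_comp)
next
  fix f X Y assume f: "f \<in> Hom (Adj C) X Y"
  show "f \<cdot>\<^bsub>Adj C\<^esub> Id (Adj C) X = f" "Id (Adj C) Y \<cdot>\<^bsub>Adj C\<^esub> f = f"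
    by (rule adj_eqI; use f ladj_hom[OF f] radj_hom[OF f] in \<open>simp add: comp_id id_comp Adj_hom\<close>)+
next
  fix f g h W X Y Z
  assume f: "f \<in> Hom (Adj C) W X" and g: "g \<in> Hom (Adj C) X Y" and h: "h \<in> Hom (Adj C) Y Z"
  show "(h \<cdot>\<^bsub>Adj C\<^esub> g) \<cdot>\<^bsub>Adj C\<^esub> f = h \<cdot>\<^bsub>Adj C\<^esub> (g \<cdot>\<^bsub>Adj C\<^esub> f)"
    by (rule adj_eqI; simp add: comp_assoc[OF ladj_hom[OF f] ladj_hom[OF g] ladj_hom[OF h]]
        comp_assoc[OF radj_hom[OF h] radj_hom[OF g] radj_hom[OF f]])
next
  fix f g X Y Z assume f: "f \<in> Hom (Adj C) X Y" and g: "g \<in> Hom (Adj C) Y Z"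
  note hom = ladj_hom[OF f] radj_hom[OF f] ladj_hom[OF g] radj_hom[OF g]
  have o: "internal_partial_order C X" "internal_partial_order C Y" "internal_partial_order C Z"
    "monotonic C X Y (ladj f)" "monotonic C Y X (radj f)"
    "monotonic C Y Z (ladj g)" "monotonic C Z Y (radj g)"
    using f g by (simp_all add: Adj_hom)
  note idX = id_hom[OF partial_order_carr[OF o(1)]] and idZ = id_hom[OF partial_order_carr[OF o(3)]]
  have "ile C X (Id C (carr X)) (radj f \<cdot> ladj f)" using f by (simp add: Adj_hom)
  \<comment> \<open>The unit of the composite is the unit of \<open>f\<close> followed by the unit
    of \<open>g\<close> at \<open>ladj f\<close>, carried along by the monotonic
    \<open>radj f\<close>. The counit below is dual.\<close>
  moreover have "ile C X (radj f \<cdot> ladj f) (radj f \<cdot> (radj g \<cdot> (ladj g \<cdot> ladj f)))"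
    using hom by (intro monotonicD[OF o(5)] Adj_unit[OF g]) (auto intro: comp_hom)
  ultimately have unit: "ile C X (Id C (carr X)) (radj f \<cdot> (radj g \<cdot> (ladj g \<cdot> ladj f)))"
    by (rule ile_trans[OF o(1) idX, rotated 2]) (use hom in \<open>auto intro!: comp_hom\<close>)
  have "ile C Z (ladj g \<cdot> (ladj f \<cdot> (radj f \<cdot> radj g))) (ladj g \<cdot> radj g)"
    using hom by (intro monotonicD[OF o(6)] Adj_counit[OF f]) (auto intro: comp_hom)
  moreover have "ile C Z (ladj g \<cdot> radj g) (Id C (carr Z))" using g by (simp add: Adj_hom)
  ultimately have counit: "ile C Z (ladj g \<cdot> (ladj f \<cdot> (radj f \<cdot> radj g))) (Id C (carr Z))"
    by (rule ile_trans[OF o(3) _ _ idZ, rotated 2]) (use hom in \<open>auto intro!: comp_hom\<close>)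
  have "(radj f \<cdot> radj g) \<cdot> (ladj g \<cdot> ladj f) = radj f \<cdot> (radj g \<cdot> (ladj g \<cdot> ladj f))"
    "(ladj g \<cdot> ladj f) \<cdot> (radj f \<cdot> radj g) = ladj g \<cdot> (ladj f \<cdot> (radj f \<cdot> radj g))"
    using hom by (simp_all add: comp_assoc_arr Hom_iff)
  then show "g \<cdot>\<^bsub>Adj C\<^esub> f \<in> Hom (Adj C) X Z"
    using f g unit counit o monotonic_comp by (simp add: Adj_hom)
qed

text \<open>For each identity one inequality is the unit or counit at an adjoint, and the other is
  the image of the opposite inequality under that adjoint. Antisymmetry turns the pair into an
  equation.\<close>

lemma Adj_triangle:
  assumes g: "g \<in> Hom (Adj C) A0 A1"
  shows "radj g \<cdot> (ladj g \<cdot> radj g) = radj g" and "ladj g \<cdot> (radj g \<cdot> ladj g) = ladj g"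
proof -
  note hom = ladj_hom[OF g] radj_hom[OF g]
  have o: "internal_partial_order C A0" "internal_partial_order C A1"
    "monotonic C A0 A1 (ladj g)" "monotonic C A1 A0 (radj g)"
    and unit: "ile C A0 (Id C (carr A0)) (radj g \<cdot> ladj g)"
    and counit: "ile C A1 (ladj g \<cdot> radj g) (Id C (carr A1))"
    using g by (simp_all add: Adj_hom)
  note ids = id_hom[OF partial_order_carr[OF o(1)]] id_hom[OF partial_order_carr[OF o(2)]]
  note comps = comp_hom[OF hom(1,2)] comp_hom[OF hom(2,1)]
  have "ile C A0 (radj g \<cdot> (ladj g \<cdot> radj g)) (radj g \<cdot> Id C (carr A1))"
    using comps ids counit by (intro monotonicD[OF o(4)])
  then show "radj g \<cdot> (ladj g \<cdot> radj g) = radj g"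
    using Adj_unit[OF g hom(2)] comp_hom[OF comps(2) hom(2)] hom
    by (intro ile_antisym[OF o(1)]) (simp_all add: comp_id)
  have "ile C A1 (ladj g \<cdot> Id C (carr A0)) (ladj g \<cdot> (radj g \<cdot> ladj g))"
    using comps ids unit by (intro monotonicD[OF o(3)])
  then show "ladj g \<cdot> (radj g \<cdot> ladj g) = ladj g"
    using Adj_counit[OF g hom(1)] comp_hom[OF comps(1) hom(1)] hom
    by (intro ile_antisym[OF o(2)]) (simp_all add: comp_id)
qed

section \<open>Orthogonality of reflections and coreflections\<close>

lemma Ref_Coref_diagonal:
  assumes "e \<in> Ref C" and e: "e \<in> Hom (Adj C) X Z" and "m \<in> Coref C" and m: "m \<in> Hom (Adj C) Z' Y"
    and u: "u \<in> Hom (Adj C) X Z'" and v: "v \<in> Hom (Adj C) Z Y"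
    and sq: "m \<cdot>\<^bsub>Adj C\<^esub> u = v \<cdot>\<^bsub>Adj C\<^esub> e"
  shows "\<exists>!d. d \<in> Hom (Adj C) Z Z' \<and> u = d \<cdot>\<^bsub>Adj C\<^esub> e \<and> m \<cdot>\<^bsub>Adj C\<^esub> d = v"
proof -
  have re: "ladj e \<cdot> radj e = Id C (carr Z)" and co: "radj m \<cdot> ladj m = Id C (carr Z')"
    using assms(1,3) e m by (auto simp: Ref_def Coref_def Adj_hom)
  note L = ladj_hom[OF e] ladj_hom[OF m] ladj_hom[OF u] ladj_hom[OF v]
    and R = radj_hom[OF e] radj_hom[OF m] radj_hom[OF u] radj_hom[OF v]
  have o: "internal_partial_order C X" "internal_partial_order C Y" "internal_partial_order C Z"
    "internal_partial_order C Z'"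
    using e m by (simp_all add: Adj_hom)
  have mono: "monotonic C X Z (ladj e)" "monotonic C Z X (radj e)"
     "monotonic C Z' Y (ladj m)" "monotonic C Y Z' (radj m)"
     "monotonic C X Z' (ladj u)" "monotonic C Z' X (radj u)"
    using e m u by (simp_all add: Adj_hom)
  have sql: "ladj m \<cdot> ladj u = ladj v \<cdot> ladj e" and sqr: "radj u \<cdot> radj m = radj e \<cdot> radj v"
    using arg_cong[OF sq, of ladj] arg_cong[OF sq, of radj] by simp_all
  \<comment> \<open>The identity \<open>ladj e \<cdot> radj e\<close> is inserted to the right of
    \<open>ladj v\<close>, the square of left adjoints is applied, and
    \<open>radj m \<cdot> ladj m\<close> cancels. For \<open>dr\<close> the roles of
    \<open>e\<close> and \<open>m\<close> are exchanged.\<close>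
  have dl: "ladj u \<cdot> radj e = radj m \<cdot> ladj v"
  proof -
    have "radj m \<cdot> ladj v = radj m \<cdot> (ladj v \<cdot> (ladj e \<cdot> radj e))"
      using L by (simp add: re comp_id)
    also have "\<dots> = radj m \<cdot> ((ladj m \<cdot> ladj u) \<cdot> radj e)"
      using comp_assoc[OF R(1) L(1) L(4)] by (simp add: sql)
    also have "\<dots> = (radj m \<cdot> ladj m) \<cdot> (ladj u \<cdot> radj e)"
      using L R by (simp add: comp_assoc_arr Hom_iff)
    finally show ?thesis using comp_hom[OF R(1) L(3)] by (simp add: co id_comp)
  qed
  have dr: "ladj e \<cdot> radj u = radj v \<cdot> ladj m"
  proof -
    have "ladj e \<cdot> radj u = ladj e \<cdot> (radj u \<cdot> (radj m \<cdot> ladj m))"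
      using R by (simp add: co comp_id)
    also have "\<dots> = ladj e \<cdot> ((radj e \<cdot> radj v) \<cdot> ladj m)"
      using comp_assoc[OF L(2) R(2) R(3)] by (simp add: sqr)
    also have "\<dots> = (ladj e \<cdot> radj e) \<cdot> (radj v \<cdot> ladj m)"
      using L R by (simp add: comp_assoc_arr Hom_iff)
    finally show ?thesis using comp_hom[OF L(2) R(4)] by (simp add: re id_comp)
  qed
  define d where "d = \<lparr>asrc = Z, atgt = Z', ladj = ladj u \<cdot> radj e, radj = ladj e \<cdot> radj u\<rparr>"
  \<comment> \<open>The unit of \<open>u\<close>, taken at \<open>radj e\<close> and pushed forward
    along \<open>ladj e\<close>, starts at the identity because \<open>e\<close> is a
    reflection.\<close>
  have "ile C Z (ladj e \<cdot> radj e) (ladj e \<cdot> (radj u \<cdot> (ladj u \<cdot> radj e)))"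
    using L R by (intro monotonicD[OF mono(1)] Adj_unit[OF u]) (auto intro: comp_hom)
  then have unit: "ile C Z (Id C (carr Z)) ((ladj e \<cdot> radj u) \<cdot> (ladj u \<cdot> radj e))"
    using L R by (simp add: comp_assoc_arr re Hom_iff)
  \<comment> \<open>Dually the counit of \<open>v\<close> at \<open>ladj m\<close>, pushed forward
    along \<open>radj m\<close>, ends at the identity because \<open>m\<close> is a coreflection.
    This needs the forms of \<open>d\<close> given by \<open>dl\<close> and
    \<open>dr\<close>.\<close>
  have "ile C Z' (radj m \<cdot> (ladj v \<cdot> (radj v \<cdot> ladj m))) (radj m \<cdot> ladj m)"
    using L R by (intro monotonicD[OF mono(4)] Adj_counit[OF v]) (auto intro: comp_hom)
  then have counit: "ile C Z' ((ladj u \<cdot> radj e) \<cdot> (ladj e \<cdot> radj u)) (Id C (carr Z'))"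
    unfolding dl dr using L R by (simp add: comp_assoc_arr co Hom_iff)
  show ?thesis
  proof (rule ex1I[of _ d], intro conjI)
    show "d \<in> Hom (Adj C) Z Z'"
      unfolding d_def using o mono unit counit by (intro Adj_homI monotonic_comp)
    have "(ladj u \<cdot> radj e) \<cdot> ladj e = radj m \<cdot> (ladj m \<cdot> ladj u)"
      unfolding dl using L R by (simp add: comp_assoc_arr sql Hom_iff)
    also have "\<dots> = ladj u"
      using comp_assoc[OF L(3) L(2) R(2)] L by (simp add: co id_comp)
    finally have "(ladj u \<cdot> radj e) \<cdot> ladj e = ladj u" .
    moreover have "radj e \<cdot> (ladj e \<cdot> radj u) = (radj u \<cdot> radj m) \<cdot> ladj m"
      unfolding dr using L R by (simp add: comp_assoc_arr sqr Hom_iff)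
    then have "radj e \<cdot> (ladj e \<cdot> radj u) = radj u"
      using comp_assoc[OF L(2) R(2) R(3)] R by (simp add: co comp_id)
    ultimately show "u = d \<cdot>\<^bsub>Adj C\<^esub> e"
      using u e by (intro adj_eqI) (simp_all add: d_def Adj_hom)
    have "ladj m \<cdot> (ladj u \<cdot> radj e) = ladj v \<cdot> (ladj e \<cdot> radj e)"
      using comp_assoc[OF R(1) L(3) L(2)] comp_assoc[OF R(1) L(1) L(4)] by (simp add: sql)
    then have "ladj m \<cdot> (ladj u \<cdot> radj e) = ladj v"
      using L by (simp add: re comp_id)
    moreover have "(ladj e \<cdot> radj u) \<cdot> radj m = (ladj e \<cdot> radj e) \<cdot> radj v"
      using comp_assoc[OF R(2) R(3) L(1)] comp_assoc[OF R(4) R(1) L(1)] by (simp add: sqr)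
    then have "(ladj e \<cdot> radj u) \<cdot> radj m = radj v"
      using R by (simp add: re id_comp)
    ultimately show "m \<cdot>\<^bsub>Adj C\<^esub> d = v"
      using m v by (intro adj_eqI) (simp_all add: d_def Adj_hom)
  next
    fix k assume k: "k \<in> Hom (Adj C) Z Z' \<and> u = k \<cdot>\<^bsub>Adj C\<^esub> e \<and> m \<cdot>\<^bsub>Adj C\<^esub> k = v"
    then have kh: "k \<in> Hom (Adj C) Z Z'" and u_eq: "ladj u = ladj k \<cdot> ladj e" "radj u = radj e \<cdot> radj k"
      by simp_all
    \<comment> \<open>A reflection is split by its right adjoint, so composing
      \<open>u = k \<cdot> e\<close> with this splitting recovers both adjoints of
      \<open>k\<close>.\<close>
    have "ladj u \<cdot> radj e = ladj k" "ladj e \<cdot> radj u = radj k"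
      using comp_assoc[OF R(1) L(1) ladj_hom[OF kh]] comp_assoc[OF radj_hom[OF kh] R(1) L(1)]
        ladj_hom[OF kh] radj_hom[OF kh]
      by (simp_all add: u_eq re comp_id id_comp)
    then show "k = d" using kh by (intro adj_eqI) (simp_all add: d_def Adj_hom)
  qed
qed

end

section \<open>The axis of an adjunction\<close>

text \<open>In \<open>polar_pair\<close> the last two equations rewrite into each other without end.
  Here every equation is oriented to remove a composite.\<close>

lemma polar_pairD:
  assumes "polar_pair B g a b"
  shows "(radj g \<cdot>\<^bsub>B\<^esub> ladj g) \<cdot>\<^bsub>B\<^esub> a = a" "(ladj g \<cdot>\<^bsub>B\<^esub> radj g) \<cdot>\<^bsub>B\<^esub> b = b"
    "radj g \<cdot>\<^bsub>B\<^esub> b = a" "ladj g \<cdot>\<^bsub>B\<^esub> a = b"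
  using assms unfolding polar_pair_def by metis+

context topos
begin

section \<open>Finite limits in a topos\<close>

lemma pullback_exists:
  assumes "f \<in> Hom B X Z" "g \<in> Hom B Y Z"
  obtains P p q where "p \<in> Hom B P X" "q \<in> Hom B P Y" "f \<cdot> p = g \<cdot> q"
    "\<And>W u v. \<lbrakk>u \<in> Hom B W X; v \<in> Hom B W Y; f \<cdot> u = g \<cdot> v\<rbrakk>
      \<Longrightarrow> \<exists>!h. h \<in> Hom B W P \<and> p \<cdot> h = u \<and> q \<cdot> h = v"
proof -
  obtain P p q where "is_pullback B f g P p q" using has_pullbacks[OF assms] by blast
  then show ?thesis using that[of p P q] assms by (auto simp: is_pullback_def Hom_iff)
qed

text \<open>The product is the pullback over the terminal object, over which every square
  commutes.\<close>

lemma product_exists: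
  assumes "X \<in> Obj B" "Y \<in> Obj B"
  obtains P p q where "p \<in> Hom B P X" "q \<in> Hom B P Y"
    "\<And>W u v. \<lbrakk>u \<in> Hom B W X; v \<in> Hom B W Y\<rbrakk> \<Longrightarrow> \<exists>!h. h \<in> Hom B W P \<and> p \<cdot> h = u \<and> q \<cdot> h = v"
proof -
  obtain T where T: "is_terminal B T" using has_terminal by blast
  obtain s t where s: "s \<in> Hom B X T" and t: "t \<in> Hom B Y T"
    using T assms unfolding is_terminal_def by metis
  obtain P p q where P: "p \<in> Hom B P X" "q \<in> Hom B P Y"
    and U: "\<And>W u v. \<lbrakk>u \<in> Hom B W X; v \<in> Hom B W Y; s \<cdot> u = t \<cdot> v\<rbrakk>
      \<Longrightarrow> \<exists>!h. h \<in> Hom B W P \<and> p \<cdot> h = u \<and> q \<cdot> h = v"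
    by (rule pullback_exists[OF s t], rule that)
  have "s \<cdot> u = t \<cdot> v" if "u \<in> Hom B W X" "v \<in> Hom B W Y" for W u v
    using T comp_hom[OF that(1) s] comp_hom[OF that(2) t] hom_obj(1)[OF that(1)]
    unfolding is_terminal_def by blast
  then show ?thesis using that[OF P] U by blast
qed

text \<open>The equalizer of \<open>f\<close> and \<open>g\<close> is the pullback of \<open>\<langle>f, g\<rangle>\<close> along the diagonal.\<close>

lemma equalizer_exists:
  assumes f: "f \<in> Hom B X Y" and g: "g \<in> Hom B X Y"
  obtains E e where "e \<in> Hom B E X" "f \<cdot> e = g \<cdot> e"
    "\<And>W h. \<lbrakk>h \<in> Hom B W X; f \<cdot> h = g \<cdot> h\<rbrakk> \<Longrightarrow> \<exists>!k. k \<in> Hom B W E \<and> e \<cdot> k = h"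
proof -
  have Y: "Y \<in> Obj B" by (rule hom_obj(2)[OF f])
  obtain P p q where P: "p \<in> Hom B P Y" "q \<in> Hom B P Y"
    and U: "\<And>W u v. \<lbrakk>u \<in> Hom B W Y; v \<in> Hom B W Y\<rbrakk> \<Longrightarrow> \<exists>!h. h \<in> Hom B W P \<and> p \<cdot> h = u \<and> q \<cdot> h = v"
    by (rule product_exists[OF Y Y], rule that)
  obtain m where m: "m \<in> Hom B X P" "p \<cdot> m = f" "q \<cdot> m = g" using U[OF f g] by blast
  obtain d where d: "d \<in> Hom B Y P" "p \<cdot> d = Id B Y" "q \<cdot> d = Id B Y"
    using U[OF id_hom[OF Y] id_hom[OF Y]] by blast
  have m_comp: "p \<cdot> (m \<cdot> h) = f \<cdot> h" "q \<cdot> (m \<cdot> h) = g \<cdot> h" if "h \<in> Hom B W X" for W h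
    using comp_assoc[OF that m(1) P(1)] comp_assoc[OF that m(1) P(2)] m by simp_all
  have d_comp: "p \<cdot> (d \<cdot> h) = h" "q \<cdot> (d \<cdot> h) = h" if "h \<in> Hom B W Y" for W h
    using comp_assoc[OF that d(1) P(1)] comp_assoc[OF that d(1) P(2)] d that by (simp_all add: id_comp)
  obtain E e e' where E: "e \<in> Hom B E X" "e' \<in> Hom B E Y" "m \<cdot> e = d \<cdot> e'"
    and V: "\<And>W u v. \<lbrakk>u \<in> Hom B W X; v \<in> Hom B W Y; m \<cdot> u = d \<cdot> v\<rbrakk>
      \<Longrightarrow> \<exists>!h. h \<in> Hom B W E \<and> e \<cdot> h = u \<and> e' \<cdot> h = v"
    by (rule pullback_exists[OF m(1) d(1)], rule that)
  \<comment> \<open>The two projections of \<open>m \<cdot> e = d \<cdot> e'\<close>.\<close>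
  have e': "e' = f \<cdot> e" "e' = g \<cdot> e"
    using m_comp[OF E(1)] d_comp[OF E(2)] E(3) by simp_all
  show ?thesis
  proof (rule that[OF E(1)])
    show "f \<cdot> e = g \<cdot> e" using e' by simp
    fix W h assume h: "h \<in> Hom B W X" and eq: "f \<cdot> h = g \<cdot> h"
    have fh: "f \<cdot> h \<in> Hom B W Y" using h f by (rule comp_hom)
    have mh: "m \<cdot> h \<in> Hom B W P" "d \<cdot> (f \<cdot> h) \<in> Hom B W P"
      using comp_hom[OF h m(1)] comp_hom[OF fh d(1)] by simp_all
    then have "m \<cdot> h = d \<cdot> (f \<cdot> h)"
      using U[OF fh fh] m_comp[OF h] d_comp[OF fh] eq by metis
    \<comment> \<open>The condition on the second leg follows from the one on \<open>e\<close>, so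
      uniqueness in the pullback becomes uniqueness with respect to \<open>e\<close> alone.\<close>
    moreover have "e' \<cdot> k = f \<cdot> h" if "k \<in> Hom B W E" "e \<cdot> k = h" for k
      using comp_assoc[OF that(1) E(1) f] that(2) e'(1) by simp
    ultimately show "\<exists>!k. k \<in> Hom B W E \<and> e \<cdot> k = h"
      using V[OF h fh] by metis
  qed
qed

text \<open>The new relation is the inverse image of the order of \<open>A\<close> along
  \<open>p\<close> on both sides, formed by two successive pullbacks: \<open>P\<close> lifts the
  first component to \<open>D\<close>, then \<open>R\<close> lifts the second. Cancellation of
  \<open>p\<close> gives antisymmetry.\<close>

lemma induced_order_exists:
  assumes A: "internal_partial_order B A" and p: "p \<in> Hom B D (carr A)"
    and mono: "\<And>X h k. \<lbrakk>h \<in> Hom B X D; k \<in> Hom B X D; p \<cdot> h = p \<cdot> k\<rbrakk> \<Longrightarrow> h = k"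
  obtains O' where "internal_partial_order B O'" "carr O' = D"
    "\<And>X u v. \<lbrakk>u \<in> Hom B X D; v \<in> Hom B X D\<rbrakk> \<Longrightarrow> ile B O' u v \<longleftrightarrow> ile B A (p \<cdot> u) (p \<cdot> v)"
proof -
  have F: "fstp A \<in> Hom B (rel A) (carr A)" and S: "sndp A \<in> Hom B (rel A) (carr A)"
    and joint: "\<And>X h k. \<lbrakk>h \<in> Hom B X (rel A); k \<in> Hom B X (rel A); fstp A \<cdot> h = fstp A \<cdot> k;
      sndp A \<cdot> h = sndp A \<cdot> k\<rbrakk> \<Longrightarrow> h = k"
    using A by (auto simp: internal_partial_order_def internal_preorder_def internal_relation_def)
  obtain P a s where P: "a \<in> Hom B P (rel A)" "s \<in> Hom B P D" "fstp A \<cdot> a = p \<cdot> s"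
    and U: "\<And>W u v. \<lbrakk>u \<in> Hom B W (rel A); v \<in> Hom B W D; fstp A \<cdot> u = p \<cdot> v\<rbrakk>
      \<Longrightarrow> \<exists>!h. h \<in> Hom B W P \<and> a \<cdot> h = u \<and> s \<cdot> h = v"
    by (rule pullback_exists[OF F p], rule that)
  have Sa: "sndp A \<cdot> a \<in> Hom B P (carr A)" using P(1) S by (rule comp_hom)
  obtain R b t where R: "b \<in> Hom B R P" "t \<in> Hom B R D" "(sndp A \<cdot> a) \<cdot> b = p \<cdot> t"
    and V: "\<And>W u v. \<lbrakk>u \<in> Hom B W P; v \<in> Hom B W D; (sndp A \<cdot> a) \<cdot> u = p \<cdot> v\<rbrakk>
      \<Longrightarrow> \<exists>!h. h \<in> Hom B W R \<and> b \<cdot> h = u \<and> t \<cdot> h = v"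
    by (rule pullback_exists[OF Sa p], rule that)
  have fst_eq: "fstp A \<cdot> (a \<cdot> (b \<cdot> h)) = p \<cdot> ((s \<cdot> b) \<cdot> h)"
    and snd_eq: "sndp A \<cdot> (a \<cdot> (b \<cdot> h)) = p \<cdot> (t \<cdot> h)" if h: "h \<in> Hom B X R" for X h
  proof -
    have "fstp A \<cdot> (a \<cdot> (b \<cdot> h)) = (fstp A \<cdot> a) \<cdot> (b \<cdot> h)"
      "sndp A \<cdot> (a \<cdot> (b \<cdot> h)) = ((sndp A \<cdot> a) \<cdot> b) \<cdot> h"
      using F S P(1) R(1) h by (simp_all add: comp_assoc_arr Hom_iff)
    then show "fstp A \<cdot> (a \<cdot> (b \<cdot> h)) = p \<cdot> ((s \<cdot> b) \<cdot> h)" "sndp A \<cdot> (a \<cdot> (b \<cdot> h)) = p \<cdot> (t \<cdot> h)"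
      unfolding P(3) R(3) using p P(2) R(1,2) h by (simp_all add: comp_assoc_arr Hom_iff)
  qed
  define O' where "O' = \<lparr>carr = D, rel = R, fstp = s \<cdot> b, sndp = t\<rparr>"
  have sb: "s \<cdot> b \<in> Hom B R D" using R(1) P(2) by (rule comp_hom)
  have ile: "ile B O' u v \<longleftrightarrow> ile B A (p \<cdot> u) (p \<cdot> v)" if u: "u \<in> Hom B X D" and v: "v \<in> Hom B X D" for X u v
  proof
    assume "ile B O' u v"
    then obtain h where h: "h \<in> Hom B X R" "(s \<cdot> b) \<cdot> h = u" "t \<cdot> h = v"
      using u by (auto simp: ile_def O'_def Hom_iff)
    have "a \<cdot> (b \<cdot> h) \<in> Hom B X (rel A)" using h(1) R(1) P(1) by (auto intro: comp_hom)
    then show "ile B A (p \<cdot> u) (p \<cdot> v)"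
      using fst_eq[OF h(1)] snd_eq[OF h(1)] comp_hom[OF u p] unfolding h ile_def
      by (auto simp: Hom_iff)
  next
    assume "ile B A (p \<cdot> u) (p \<cdot> v)"
    then obtain h where h: "h \<in> Hom B X (rel A)" "fstp A \<cdot> h = p \<cdot> u" "sndp A \<cdot> h = p \<cdot> v"
      using comp_hom[OF u p] by (auto simp: ile_def Hom_iff)
    obtain k where k: "k \<in> Hom B X P" "a \<cdot> k = h" "s \<cdot> k = u" using U[OF h(1) u h(2)] by blast
    have "(sndp A \<cdot> a) \<cdot> k = p \<cdot> v" using comp_assoc[OF k(1) P(1) S] k h by simp
    from V[OF k(1) v this] obtain l where l: "l \<in> Hom B X R" "b \<cdot> l = k" "t \<cdot> l = v" by blast
    moreover have "(s \<cdot> b) \<cdot> l = u" using comp_assoc[OF l(1) R(1) P(2)] l(2) k(3) by simp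
    ultimately show "ile B O' u v" using u by (auto simp: ile_def O'_def Hom_iff)
  qed
  \<comment> \<open>Joint monicity is climbed in three stages: the components in
    \<open>rel A\<close> agree by \<open>joint\<close>, those in \<open>P\<close> by uniqueness in
    the first pullback, and those in \<open>R\<close> by uniqueness in the second.\<close>
  have "h = k" if h: "h \<in> Hom B X R" and k: "k \<in> Hom B X R"
    and eq: "(s \<cdot> b) \<cdot> h = (s \<cdot> b) \<cdot> k" "t \<cdot> h = t \<cdot> k" for X h k
  proof -
    have bh: "b \<cdot> h \<in> Hom B X P" "b \<cdot> k \<in> Hom B X P"
      using comp_hom[OF h R(1)] comp_hom[OF k R(1)] by simp_all
    have abh: "a \<cdot> (b \<cdot> h) \<in> Hom B X (rel A)" "a \<cdot> (b \<cdot> k) \<in> Hom B X (rel A)"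
      using comp_hom[OF bh(1) P(1)] comp_hom[OF bh(2) P(1)] by simp_all
    have ab: "a \<cdot> (b \<cdot> h) = a \<cdot> (b \<cdot> k)"
      using fst_eq[OF h] fst_eq[OF k] snd_eq[OF h] snd_eq[OF k] eq by (intro joint[OF abh]) simp_all
    have sbh: "s \<cdot> (b \<cdot> h) = (s \<cdot> b) \<cdot> h" "s \<cdot> (b \<cdot> k) = (s \<cdot> b) \<cdot> k"
      using comp_assoc[OF h R(1) P(2)] comp_assoc[OF k R(1) P(2)] by simp_all
    have "fstp A \<cdot> (a \<cdot> (b \<cdot> h)) = p \<cdot> (s \<cdot> (b \<cdot> h))" using fst_eq[OF h] sbh by simp
    from U[OF abh(1) comp_hom[OF bh(1) P(2)] this] have bhk: "b \<cdot> h = b \<cdot> k"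
      using bh ab sbh eq(1) by metis
    have "(sndp A \<cdot> a) \<cdot> (b \<cdot> h) = p \<cdot> (t \<cdot> h)"
      using comp_assoc[OF bh(1) P(1) S] snd_eq[OF h] by simp
    from V[OF bh(1) comp_hom[OF h R(2)] this] show "h = k" using h k bhk eq(2) by metis
  qed
  then have rel: "internal_relation B O'"
    using sb R(2) unfolding internal_relation_def O'_def by auto
  have ph: "p \<cdot> u \<in> Hom B X (carr A)" if "u \<in> Hom B X D" for X u using that p by (rule comp_hom)
  have carr: "carr O' = D" by (simp add: O'_def)
  have "internal_partial_order B O'"
    unfolding internal_partial_order_def internal_preorder_def carr
  proof (intro conjI allI ballI impI)
    show "internal_relation B O'" by (fact rel)
  next
    fix X u assume "u \<in> Hom B X D"
    then show "ile B O' u u" using ile ile_refl[OF A ph] by blast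
  next
    fix X u v w assume u: "u \<in> Hom B X D" "v \<in> Hom B X D" "w \<in> Hom B X D"
      and "ile B O' u v \<and> ile B O' v w"
    then show "ile B O' u w" using ile ile_trans[OF A ph[OF u(1)] ph[OF u(2)] ph[OF u(3)]] by blast
  next
    fix X u v assume u: "u \<in> Hom B X D" "v \<in> Hom B X D" and "ile B O' u v \<and> ile B O' v u"
    then show "u = v" using ile ile_antisym[OF A ph[OF u(1)] ph[OF u(2)]] mono[OF u] by blast
  qed
  then show ?thesis using carr ile by (rule that)
qed

text \<open>A polar pair is determined by its closed component, so the axis is carried by the equalizer
  of the closure operator and the identity.\<close>

lemma axis_exists:
  assumes "g \<in> Arr (Adj B)"
  shows "is_axis B g (axis B g)"
proof -
  define A0 A1 where "A0 = asrc g" and "A1 = atgt g"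
  have g: "g \<in> Hom (Adj B) A0 A1" using assms by (simp add: Adj_arr A0_def A1_def)
  have o: "internal_partial_order B A0" "internal_partial_order B A1" "monotonic B A0 A1 (ladj g)"
    using g by (simp_all add: Adj_hom)
  note L = ladj_hom[OF g] and R = radj_hom[OF g]
  have RL: "radj g \<cdot> ladj g \<in> Hom B (carr A0) (carr A0)" using L R by (rule comp_hom)
  have id: "Id B (carr A0) \<in> Hom B (carr A0) (carr A0)" using o(1) by (simp add: id_hom partial_order_carr)
  obtain D p where D: "p \<in> Hom B D (carr A0)" "(radj g \<cdot> ladj g) \<cdot> p = Id B (carr A0) \<cdot> p"
    and U: "\<And>W h. \<lbrakk>h \<in> Hom B W (carr A0); (radj g \<cdot> ladj g) \<cdot> h = Id B (carr A0) \<cdot> h\<rbrakk>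
      \<Longrightarrow> \<exists>!k. k \<in> Hom B W D \<and> p \<cdot> k = h"
    by (rule equalizer_exists[OF RL id], rule that)
  have fixed: "(radj g \<cdot> ladj g) \<cdot> p = p" using D by (simp add: id_comp)
  then have closed: "radj g \<cdot> (ladj g \<cdot> p) = p" using comp_assoc[OF D(1) L R] by simp
  have mono: "h = k" if h: "h \<in> Hom B X D" and k: "k \<in> Hom B X D" and eq: "p \<cdot> h = p \<cdot> k" for X h k
  proof -
    have ph: "p \<cdot> h \<in> Hom B X (carr A0)" using h D(1) by (rule comp_hom)
    have "(radj g \<cdot> ladj g) \<cdot> (p \<cdot> h) = Id B (carr A0) \<cdot> (p \<cdot> h)"
      using comp_assoc[OF h D(1) RL] fixed ph by (simp add: id_comp)
    from U[OF ph this] show ?thesis using h k eq by auto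
  qed
  obtain O' where O': "internal_partial_order B O'" "carr O' = D"
    and ile: "\<And>X u v. \<lbrakk>u \<in> Hom B X D; v \<in> Hom B X D\<rbrakk> \<Longrightarrow> ile B O' u v \<longleftrightarrow> ile B A0 (p \<cdot> u) (p \<cdot> v)"
    by (rule induced_order_exists[OF o(1) D(1)], erule (2) mono, rule that)
  \<comment> \<open>The equation \<open>b = ladj g \<cdot> a\<close> of a polar pair forces this
    second projection.\<close>
  define q where "q = ladj g \<cdot> p"
  have q: "q \<in> Hom B D (carr A1)" unfolding q_def using D(1) L by (rule comp_hom)
  have q_comp: "q \<cdot> u = ladj g \<cdot> (p \<cdot> u)" if "u \<in> Hom B X D" for X u
    using comp_assoc[OF that D(1) L] by (simp add: q_def)
  have "is_axis B g (O', p, q)"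
    unfolding is_axis_def case_prod_conv A0_def[symmetric] A1_def[symmetric] O'(2)
  proof (intro conjI allI ballI impI)
    show "internal_partial_order B O'" "p \<in> Hom B D (carr A0)" "q \<in> Hom B D (carr A1)" by fact+
    show "polar_pair B g p q"
      using comp_assoc[OF q R L] closed fixed by (simp add: polar_pair_def q_def)
  next
    fix X a b assume a: "a \<in> Hom B X (carr A0)" and ab: "polar_pair B g a b"
    have "\<exists>!u. u \<in> Hom B X D \<and> p \<cdot> u = a"
      using a polar_pairD(1)[OF ab] by (intro U) (simp_all add: id_comp)
    moreover have "q \<cdot> u = b" if "u \<in> Hom B X D" "p \<cdot> u = a" for u
      using q_comp[OF that(1)] that(2) polar_pairD(4)[OF ab] by simp
    ultimately show "\<exists>!u. u \<in> Hom B X D \<and> p \<cdot> u = a \<and> q \<cdot> u = b" by blast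
  next
    fix X u v assume u: "u \<in> Hom B X D" and v: "v \<in> Hom B X D"
    \<comment> \<open>Since \<open>ladj g\<close> is monotonic, comparison of first components
      implies that of second components; the order induced along \<open>p\<close> is therefore the
      componentwise one.\<close>
    show "ile B O' u v \<longleftrightarrow> ile B A0 (p \<cdot> u) (p \<cdot> v) \<and> ile B A1 (q \<cdot> u) (q \<cdot> v)"
      unfolding ile[OF u v] q_comp[OF u] q_comp[OF v]
      using monotonicD[OF o(3) comp_hom[OF u D(1)] comp_hom[OF v D(1)]] by blast
  qed
  then show ?thesis unfolding axis_def by (rule someI[of "is_axis B g"])
qed

end

section \<open>Polar factorization\<close>

text \<open>Naming the parts of the chosen axis lets \<open>axis_eq\<close> resolve the case
  expressions in \<open>extent\<close>, \<open>intent\<close> and \<open>axis_pair\<close>.\<close>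

locale adjunction_axis = category B for B :: "('o, 'm) cat" (structure) +
  fixes g :: "('o, 'm) adj" and D :: "('o, 'm) iord" and p q :: 'm
  assumes g_arr: "g \<in> Arr (Adj B)" and axis_eq: "axis B g = (D, p, q)"
    and axis: "is_axis B g (D, p, q)"
begin

abbreviation "A0 \<equiv> asrc g"
abbreviation "A1 \<equiv> atgt g"

lemma g_hom: "g \<in> Hom (Adj B) A0 A1"
  using g_arr by (simp add: Adj_arr)

lemmas L = ladj_hom[OF g_hom] and R = radj_hom[OF g_hom]

lemma orders:
  "internal_partial_order B A0" "internal_partial_order B A1" "internal_partial_order B D"
  "monotonic B A0 A1 (ladj g)" "monotonic B A1 A0 (radj g)"
  using g_hom axis by (simp_all add: Adj_hom is_axis_def)

lemma projections:
  "p \<in> Hom B (carr D) (carr A0)" "q \<in> Hom B (carr D) (carr A1)"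
  "radj g \<cdot> q = p" "ladj g \<cdot> p = q"
  "(radj g \<cdot> ladj g) \<cdot> p = p" "(ladj g \<cdot> radj g) \<cdot> q = q"
  using axis polar_pairD[of B g p q] by (auto simp: is_axis_def)

lemma axis_ile:
  "\<lbrakk>u \<in> Hom B X (carr D); v \<in> Hom B X (carr D)\<rbrakk>
    \<Longrightarrow> ile B D u v \<longleftrightarrow> ile B A0 (p \<cdot> u) (p \<cdot> v) \<and> ile B A1 (q \<cdot> u) (q \<cdot> v)"
  using axis unfolding is_axis_def by blast

lemma axis_pair:
  assumes a: "a \<in> Hom B X (carr A0)" and b: "b \<in> Hom B X (carr A1)" and "polar_pair B g a b"
  shows "axis_pair B g a b \<in> Hom B X (carr D)"
    and "p \<cdot> axis_pair B g a b = a" and "q \<cdot> axis_pair B g a b = b"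
proof -
  have "\<exists>!u. u \<in> Hom B X (carr D) \<and> p \<cdot> u = a \<and> q \<cdot> u = b"
    using axis assms unfolding is_axis_def by blast
  from theI'[OF this] show "axis_pair B g a b \<in> Hom B X (carr D)"
    and "p \<cdot> axis_pair B g a b = a" and "q \<cdot> axis_pair B g a b = b"
    using a by (auto simp: axis_pair_def axis_eq Hom_iff)
qed

text \<open>Equal components are comparable in both directions by reflexivity, hence antisymmetry of
  \<open>D\<close> applies.\<close>

lemma axis_eqI:
  assumes u: "u \<in> Hom B X (carr D)" and v: "v \<in> Hom B X (carr D)"
    and eq: "p \<cdot> u = p \<cdot> v" "q \<cdot> u = q \<cdot> v"
  shows "u = v"
proof (rule ile_antisym[OF orders(3) u v])
  show "ile B D u v" "ile B D v u"
    using axis_ile[OF u v] axis_ile[OF v u] eq ile_refl[OF orders(1) comp_hom[OF v projections(1)]]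
      ile_refl[OF orders(2) comp_hom[OF v projections(2)]]
    by simp_all
qed

text \<open>The equations come from associativity and the triangle identities. The pair is the
  closure of the generic element of \<open>A0\<close> with its image; the intent pair is
  dual.\<close>

lemma polar_pair_extent: "polar_pair B g (radj g \<cdot> ladj g) (ladj g)"
  unfolding polar_pair_def
  using Adj_triangle[OF g_hom] L R by (simp add: comp_assoc_arr Hom_iff)

lemma polar_pair_intent: "polar_pair B g (radj g) (ladj g \<cdot> radj g)"
  unfolding polar_pair_def
  using Adj_triangle[OF g_hom] L R by (simp add: comp_assoc_arr Hom_iff)

lemmas RL = comp_hom[OF L R] and LR = comp_hom[OF R L]
lemmas extent_pair = axis_pair[OF RL L polar_pair_extent]
lemmas intent_pair = axis_pair[OF R LR polar_pair_intent]

text \<open>Tested on the two projections: the closure fixes \<open>p\<close>, and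
  \<open>ladj g\<close> carries \<open>p\<close> to \<open>q\<close>. This is the equation that
  makes the extent a reflection.\<close>

lemma extent_retract: "axis_pair B g (radj g \<cdot> ladj g) (ladj g) \<cdot> p = Id B (carr D)" (is "?e \<cdot> p = _")
proof (rule axis_eqI)
  show "?e \<cdot> p \<in> Hom B (carr D) (carr D)" using projections(1) extent_pair(1) by (rule comp_hom)
  show "Id B (carr D) \<in> Hom B (carr D) (carr D)" using orders(3) by (simp add: id_hom partial_order_carr)
  show "p \<cdot> ?e \<cdot> p = p \<cdot> Id B (carr D)" "q \<cdot> ?e \<cdot> p = q \<cdot> Id B (carr D)"
    using comp_assoc[OF projections(1) extent_pair(1) projections(1)]
      comp_assoc[OF projections(1) extent_pair(1) projections(2)] projections
    by (simp_all add: extent_pair comp_id)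
qed

text \<open>Dually \<open>radj g\<close> carries \<open>q\<close> to \<open>p\<close> and the
  interior fixes \<open>q\<close>, which makes the intent a coreflection.\<close>

lemma intent_retract: "axis_pair B g (radj g) (ladj g \<cdot> radj g) \<cdot> q = Id B (carr D)" (is "?m \<cdot> q = _")
proof (rule axis_eqI)
  show "?m \<cdot> q \<in> Hom B (carr D) (carr D)" using projections(2) intent_pair(1) by (rule comp_hom)
  show "Id B (carr D) \<in> Hom B (carr D) (carr D)" using orders(3) by (simp add: id_hom partial_order_carr)
  show "p \<cdot> ?m \<cdot> q = p \<cdot> Id B (carr D)" "q \<cdot> ?m \<cdot> q = q \<cdot> Id B (carr D)"
    using comp_assoc[OF projections(2) intent_pair(1) projections(1)]
      comp_assoc[OF projections(2) intent_pair(1) projections(2)] projections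
    by (simp_all add: intent_pair comp_id)
qed

lemma projections_monotonic: "monotonic B D A0 p" "monotonic B D A1 q"
  using projections axis_ile by (auto simp: monotonic_def)

lemma pair_monotonic:
  assumes A: "monotonic B A A0 a" "monotonic B A A1 b"
    and u: "u \<in> Hom B (carr A) (carr D)" "p \<cdot> u = a" "q \<cdot> u = b"
  shows "monotonic B A D u"
  unfolding monotonic_def
proof (intro conjI allI ballI impI)
  fix X v w assume v: "v \<in> Hom B X (carr A)" and w: "w \<in> Hom B X (carr A)" and le: "ile B A v w"
  have "p \<cdot> (u \<cdot> x) = a \<cdot> x" "q \<cdot> (u \<cdot> x) = b \<cdot> x" if "x \<in> Hom B X (carr A)" for x
    using comp_assoc[OF that u(1) projections(1)] comp_assoc[OF that u(1) projections(2)] u(2,3)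
    by simp_all
  then show "ile B D (u \<cdot> v) (u \<cdot> w)"
    using v w axis_ile[OF comp_hom[OF v u(1)] comp_hom[OF w u(1)]]
      monotonicD[OF A(1) v w le] monotonicD[OF A(2) v w le]
    by simp
qed (fact u(1))

text \<open>By the retract equations, the counit of the extent and the unit of the intent take this
  form.\<close>

lemma ids: "ile B D (Id B (carr D)) (Id B (carr D))"
  using ile_refl[OF orders(3) id_hom] orders(3) by (simp add: partial_order_carr)

lemma extent_hom: "extent B g \<in> Hom (Adj B) A0 D"
  unfolding extent_def axis_eq case_prod_conv
proof (rule Adj_homI)
  show "monotonic B A0 D (axis_pair B g (radj g \<cdot> ladj g) (ladj g))"
    using monotonic_comp[OF orders(4,5)] orders(4) extent_pair by (rule pair_monotonic)
  \<comment> \<open>Projecting the pair gives \<open>radj g \<cdot> ladj g\<close>, so this is the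
    unit of \<open>g\<close>.\<close>
  show "ile B A0 (Id B (carr A0)) (p \<cdot> axis_pair B g (radj g \<cdot> ladj g) (ladj g))"
    using g_hom by (simp add: extent_pair Adj_hom)
qed (simp_all add: orders projections_monotonic extent_retract ids)

lemma intent_hom: "intent B g \<in> Hom (Adj B) D A1"
  unfolding intent_def axis_eq case_prod_conv
proof (rule Adj_homI)
  show "monotonic B A1 D (axis_pair B g (radj g) (ladj g \<cdot> radj g))"
    using orders(5) monotonic_comp[OF orders(5,4)] intent_pair by (rule pair_monotonic)
  show "ile B A1 (q \<cdot> axis_pair B g (radj g) (ladj g \<cdot> radj g)) (Id B (carr A1))"
    using g_hom by (simp add: intent_pair Adj_hom)
qed (simp_all add: orders projections_monotonic intent_retract ids)

lemma extent_Ref: "extent B g \<in> Ref B"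
  using extent_hom extent_retract by (auto simp: Ref_def extent_def axis_eq Hom_iff)

lemma intent_Coref: "intent B g \<in> Coref B"
  using intent_hom intent_retract by (auto simp: Coref_def intent_def axis_eq Hom_iff)

text \<open>The left adjoint of the composite is the second component of the extent pair, and its
  right adjoint is the first component of the intent pair.\<close>

lemma intent_extent: "intent B g \<cdot>\<^bsub>Adj B\<^esub> extent B g = g"
  by (rule adj_eqI) (simp_all add: extent_def intent_def axis_eq extent_pair intent_pair)

end

section \<open>The equivalence mediated by polar factorization\<close>

theorem (in topos) polar_factorization_system:
  "factorization_system (Adj B) (Ref B) (Coref B) (extent B) (intent B) (\<lambda>g. fst (axis B g))"
proof -
  have ax: "adjunction_axis B g (fst (axis B g)) (fst (snd (axis B g))) (snd (snd (axis B g)))"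
    if "g \<in> Arr (Adj B)" for g
    using that axis_exists[OF that] category_axioms
    by (simp add: adjunction_axis_def adjunction_axis_axioms_def)
  show ?thesis
    unfolding factorization_system_def factorization_system_axioms_def
    using category_Adj ax[THEN adjunction_axis.extent_Ref] ax[THEN adjunction_axis.intent_Coref]
      ax[THEN adjunction_axis.extent_hom] ax[THEN adjunction_axis.intent_hom]
      ax[THEN adjunction_axis.intent_extent] Ref_Coref_diagonal
    by simp
qed

text \<open>The first conjunct certifies that \<open>axis\<close> picks a genuine axis and not an
  arbitrary value of the choice operator, so the functors in the second are the intended
  ones.\<close>

theorem theorem2:
  fixes B :: "('o, 'm) cat"
  assumes "topos B"
  shows "(\<forall>g \<in> Arr (Adj B). is_axis B g (axis B g)) \<and>
         equivalence_of_categories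
           (arrow_category (Adj B))
           (factorization_category (Adj B) (Ref B) (Coref B))
           (polar_functor B)
           (composition_functor (Adj B))"
proof -
  interpret topos B by fact
  interpret polar: factorization_system "Adj B" "Ref B" "Coref B" "extent B" "intent B"
    "\<lambda>g. fst (axis B g)"
    by (rule polar_factorization_system)
  have "polar_functor B = polar.factor_functor"
    by (simp add: polar_functor_def polar.factor_functor_def polar.filler_def polar.factor_def
        polar_factorization_def fun_eq_iff)
  then show ?thesis
    using axis_exists polar.equivalence_arrow_factorization by simp
qed

end
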